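(* Let $t$ be a term and let $Q$ be an initial skeleton for $t$. If $Q' \triangleright t : \langle \Gamma \vdash T\rangle / C$ is derivable, then there exist a substitution $\sigma$, a type environment $\Gamma'$ and a reflexive constraint $C'$ such that $([\sigma]Q)^{+\Gamma'} \triangleright t : \langle \Gamma \vdash T\rangle / (C\wedge C')$, where $(\cdot)^{+\Gamma'}$ denotes one use of the weakening rule.
   Context: **Syntax of System $F_s$.** Term variables $x,y$; type variables $a,b$; expansion variables (E-variables) $s$ (three countably infinite sorts). $A$ ranges over finite sets of type variables. - Terms: $t ::= x \mid \lambda x.t \mid t_1@t_2$ (untyped $\lambda$-terms, $@$ is application). $\mathrm{fv}(t)$ is the set of free variables. - Types: $T ::= a \mid T_1\to T_2 \mid \forall a.T \mid s^A T$. - Substitutions: $\sigma ::= (a:=T,\sigma) \mid (s:=E,\sigma) \mid \square$. - Expansions: $E ::= \epsilon \mid \forall a.E \mid s^A E \mid E^{:T}$. - Constraints: $C ::= \omega \mid T_1\lessdot T_2 \mid C_1\wedge C_2 \mid \exists a.C \mid s^A_T C$. - Type environments $\Gamma$: lists of assignments $x:T$ of types to pairwise distinct term variables, regarded as finite maps from term variables to types; $\mathrm{supp}(\Gamma)$ is the set of assigned variables and $\Gamma(x)$ the type assigned to $x$. - Skeletons: $Q ::= x^{\Gamma} \mid \lambda x.Q \mid Q_1@Q_2 \mid \forall a.Q \mid s^A Q \mid Q^{:T}$. **Equalities.** Bound variables may be $\alpha$-converted in types ($\forall a.T$ binds $a$), skeletons ($\lambda x.Q$ binds $x$, $\forall a.Q$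 binds $a$) and constraints ($\exists a.C$ binds $a$); in an expansion $\forall a.E$ the variable $a$ is not bound. Types are identified up to $\forall a.\forall b.T=\forall b.\forall a.T$ and $\forall a.T=T$ if $a$ is not free in $T$. Constraints are identified up to associativity, commutativity and idempotence of $\wedge$, $C\wedge\omega=C$, $\exists a.(C_1\wedge C_2)=(\exists a.C_1)\wedge(\exists a.C_2)$, $s^A_T(C_1\wedge C_2)=(s^A_TC_1)\wedge(s^A_TC_2)$, and $\exists a.C=C$ if $a$ is not free in $C$. **Free type variables.** $\mathrm{ftv}(a)=\{a\}$; $\mathrm{ftv}(T_1\to T_2)=\mathrm{ftv}(T_1)\cup\mathrm{ftv}(T_2)$; $\mathrm{ftv}(\forall a.T)=\mathrm{ftv}(T)\setminus\{a\}$; $\mathrm{ftv}(s^AT)=\mathrm{ftv}(T)\cup A$; $\mathrm{ftv}(\epsilon)=\emptyset$; $\mathrm{ftv}(E^{:T})=\mathrm{ftv}(E)\cup\mathrm{ftv}(T)$; $\mathrm{ftv}(\forall a.E)=\mathrm{ftv}(E)\cup\{a\}$; $\mathrm{ftv}(s^AE)=\mathrm{ftv}(E)\cup A$; $\mathrm{ftv}(\square)=\emptyset$; $\mathrm{ftv}(a:=T,\sigma)=\{a\}\cup\mathrm{ftv}(T)\cup\mathrm{ftv}(\sigma)$; $\mathrm{ftv}(s:=E,\sigma)=\mathrm{ftv}(E)\cup\mathrm{ftv}(\sigma)$; $\mathrm{ftv}$ of an environment or of a finite set of types is the union of the $\mathrm{ftv}$ of its types. **Typing rules** for judgements $Q\triangleright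 t:\langle\Gamma\vdash T\rangle/C$: - $x^\Gamma\triangleright x:\langle\Gamma\vdash\Gamma(x)\rangle/\omega$. - If $Q\triangleright t:\langle\Gamma,x:T_1\vdash T_2\rangle/C$ then $\lambda x.Q\triangleright\lambda x.t:\langle\Gamma\vdash T_1\to T_2\rangle/C$. - If $Q_1\triangleright t_1:\langle\Gamma\vdash T_1\to T_2\rangle/C_1$ and $Q_2\triangleright t_2:\langle\Gamma\vdash T_1\rangle/C_2$ then $Q_1@Q_2\triangleright t_1@t_2:\langle\Gamma\vdash T_2\rangle/(C_1\wedge C_2)$. - If $Q\triangleright t:\langle\Gamma\vdash T\rangle/C$ and $a\notin\mathrm{ftv}(\Gamma)$ then $\forall a.Q\triangleright t:\langle\Gamma\vdash\forall a.T\rangle/\exists a.C$. - If $Q\triangleright t:\langle\Gamma\vdash T\rangle/C$ and $\mathrm{ftv}(\Gamma)\subseteq A$ then $s^AQ\triangleright t:\langle\Gamma\vdash s^AT\rangle/s^A_TC$. - If $Q\triangleright t:\langle\Gamma\vdash T_1\rangle/C$ then $Q^{:T_2}\triangleright t:\langle\Gamma\vdash T_2\rangle/(C\wedge(T_1\lessdot T_2))$. A skeleton is valid if it occurs in some derivable judgement; only valid skeletons are considered. $Q$ determines $t,\Gamma,T,C$; write $\mathrm{tenv}(Q)=\Gamma$, $\mathrm{rtype}(Q)=T$. **Expansion application.** For $X$ a type or a skeleton: $[\epsilon]^AX=X$; $[s^{A'}E]^AX=s^{A\cup A'}([E]^AX)$; $[\forall a.E]^AX=\forall a.[E]^AX$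 if $a\notin A$, and $=[E]^AX$ otherwise; $[E^{:T_2}]^AT_1=T_2$; $[E^{:T_2}]^AQ=([E]^AQ)^{:T_2}$. For constraints (with an extra type parameter): $[\epsilon]^A_TC=C$; $[s^{A'}E]^A_TC=s^{A\cup A'}_{[E]^AT}([E]^A_TC)$; $[\forall a.E]^A_TC=\exists a.[E]^A_TC$ if $a\notin A$, and $=[E]^A_TC$ otherwise; $[E^{:T_2}]^A_{T_1}C=([E]^A_{T_1}C)\wedge(([E]^AT_1)\lessdot T_2)$. **Substitution application.** Let $v$ range over type variables and E-variables, and let $\Phi$ be a type or an expansion of the matching kind. $[\square]a=a$; $[\square]s=s^\emptyset\epsilon$; $[(v:=\Phi,\sigma)]v=\Phi$; $[(v:=\Phi,\sigma)]v'=[\sigma]v'$ if $v\ne v'$. On sets $A$ and environments it is pointwise (so $[\sigma]A$ is a finite set of types and $[\sigma]\Gamma$ maps $x$ to $[\sigma](\Gamma(x))$). On types: $[\sigma](s^AT)=[[\sigma]s]^{\mathrm{ftv}([\sigma]A)}[\sigma]T$; $[\sigma]\forall a.T=\forall a.[\sigma]T$ if $a\notin\mathrm{ftv}(\sigma)$; $[\sigma](T_1\to T_2)=[\sigma]T_1\to[\sigma]T_2$. On skeletons: $[\sigma]x^\Gamma=x^{[\sigma]\Gamma}$; $[\sigma]\lambda x.Q=\lambda x.[\sigma]Q$; $[\sigma](Q_1@Q_2)=[\sigma]Q_1@[\sigma]Q_2$; $[\sigma](s^AQ)=[[\sigma]s]^{\mathrm{ftv}([\sigma]A)}[\sigma]Q$;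 $[\sigma]\forall a.Q=\forall a.[\sigma]Q$ if $a\notin\mathrm{ftv}(\sigma)$; $[\sigma](Q^{:T})=([\sigma]Q)^{:[\sigma]T}$. On constraints: $[\sigma]\omega=\omega$; $[\sigma](T_1\lessdot T_2)=[\sigma]T_1\lessdot[\sigma]T_2$; $[\sigma](s^A_TC)=[[\sigma]s]^{\mathrm{ftv}([\sigma]A)}_{[\sigma]T}[\sigma]C$; $[\sigma]\exists a.C=\exists a.[\sigma]C$ if $a\notin\mathrm{ftv}(\sigma)$; $[\sigma](C_1\wedge C_2)=[\sigma]C_1\wedge[\sigma]C_2$. **Initial skeletons.** A variable environment $\Xi$ is a type environment assigning type variables to term variables, with distinct term variables mapped to distinct type variables. $\mathrm{var}(Q)$ is the set of free type variables and E-variables occurring in $Q$. The relation $\mathrm{init}(\Xi,t,Q)$ is defined inductively: - $\mathrm{init}(\Xi,x,s^{\mathrm{ftv}(\Xi)}x^{\Xi})$. - If $\mathrm{init}((\Xi,x:a),t,Q)$, $s\notin\mathrm{var}(Q)$ and $A=\mathrm{ftv}(\mathrm{tenv}(\lambda x.Q))$, then $\mathrm{init}(\Xi,\lambda x.t,s^A(\lambda x.Q))$. - If $\mathrm{init}(\Xi,t_1,Q_1)$, $\mathrm{init}(\Xi,t_2,Q_2)$, $Q=Q_1^{:\mathrm{rtype}(Q_2)\to a}@Q_2$, $A=\mathrm{ftv}(\mathrm{tenv}(Q))$, $(\mathrm{var}(Q_1)\cap\mathrm{var}(Q_2))\setminus\mathrm{ftv}(\Xi)=\emptyset$ and $\{a,s\}\cap(\mathrm{var}(Q_1)\cup\mathrm{var}(Q_2))=\emptyset$,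 then $\mathrm{init}(\Xi,t_1@t_2,s^AQ)$. $Q$ is an initial skeleton for $t$ if $\mathrm{init}(\Xi,t,Q)$ for some $\Xi$ with $\mathrm{supp}(\Xi)=\mathrm{fv}(t)$. **Reflexive constraints** are defined inductively: $\omega$ and $T\lessdot T$ are reflexive; if $C$ is reflexive so are $\exists a.C$ and $s^A_TC$; if $C_1,C_2$ are reflexive so is $C_1\wedge C_2$. **Weakening rule** (added to the typing rules, with a new skeleton form $Q^{+\Gamma_2}$): if $Q\triangleright t:\langle\Gamma_1\vdash T\rangle/C$ and $\mathrm{supp}(\Gamma_1)\cap\mathrm{supp}(\Gamma_2)=\emptyset$, then $Q^{+\Gamma_2}\triangleright t:\langle\Gamma_1,\Gamma_2\vdash T\rangle/C$. The hypothesis judgement on $Q'$ is one derived with the typing rules listed above (without weakening); weakening is used in the conclusion. *)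

theory Defs
  imports "HOL-Library.Finite_Map" "HOL-Combinatorics.Transposition"
begin

text \<open>
  Terms, types, constraints and skeletons are quotients of raw (named) syntax trees by the
  identifications of System \<open>F\<^sub>s\<close>: \<open>\<alpha>\<close>-conversion everywhere, plus the extra equations
  for types and constraints.  All objects below are therefore compared with \<open>=\<close>.
  In each raw \<open>\<alpha>\<close>-rule the new name is not free in the body and is exchanged with the old
  one by a transposition of names.  The sets \<open>A\<close> of type variables are finite sets.
\<close>

datatype tmvar = TmVar nat
datatype tyvar = TyVar nat
datatype evar = EVar nat

abbreviation fUnions :: "('a \<Rightarrow> 'b fset) \<Rightarrow> 'a fset \<Rightarrow> 'b fset" where
  "fUnions f A \<equiv> ffUnion (f |`| A)"

lemma fUnions_iff [simp]: "x |\<in>| fUnions f A \<longleftrightarrow> (\<exists>y. y |\<in>| A \<and> x |\<in>| f y)"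
  by (auto simp: ffUnion.rep_eq fimage.rep_eq)

lemma fin_transpose_image: "x |\<in>| transpose a b |`| A \<longleftrightarrow> transpose a b x |\<in>| A"
  by (metis fimage_eqI fimageE transpose_involutory)

lemmas fin_swap = fin_transpose_image in_transpose_image_iff

lemma fminus_swap: "b |\<notin>| A \<Longrightarrow> transpose a b |`| A |-| {|b|} = A |-| {|a|}"
  by (rule fset_eqI, simp only: fminus_iff fin_swap fsingleton_iff) (simp add: transpose_def)

lemma fminus_triv_single: "a |\<notin>| A \<Longrightarrow> A |-| {|a|} = A"
  by auto

lemma fminus_commute: "A |-| {|a|} |-| {|b|} = A |-| {|b|} |-| {|a|}"
  by auto

lemma swap_fminus: "transpose a b |`| (A |-| {|c|}) = transpose a b |`| A |-| {|transpose a b c|}"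
  by (rule fset_eqI, simp only: fminus_iff fin_swap fsingleton_iff)
    (metis transpose_involutory)

lemma transpose_conj:
  "transpose a b (transpose c d x) = transpose (transpose a b c) (transpose a b d) (transpose a b x)"
  unfolding transpose_def
  by (cases "x = c"; cases "x = d"; cases "x = a"; cases "x = b";
      cases "c = a"; cases "c = b"; cases "d = a"; cases "d = b"; simp)


section \<open>Terms\<close>

datatype raw_tm = RVar tmvar | RLam tmvar raw_tm | RApp raw_tm raw_tm

primrec fv_raw_tm :: "raw_tm \<Rightarrow> tmvar fset" where
  "fv_raw_tm (RVar x) = {|x|}"
| "fv_raw_tm (RLam x t) = fv_raw_tm t |-| {|x|}"
| "fv_raw_tm (RApp t u) = fv_raw_tm t |\<union>| fv_raw_tm u"

primrec swap_raw_tm :: "tmvar \<Rightarrow> tmvar \<Rightarrow> raw_tm \<Rightarrow> raw_tm" where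
  "swap_raw_tm x y (RVar z) = RVar (transpose x y z)"
| "swap_raw_tm x y (RLam z t) = RLam (transpose x y z) (swap_raw_tm x y t)"
| "swap_raw_tm x y (RApp t u) = RApp (swap_raw_tm x y t) (swap_raw_tm x y u)"

inductive tm_eq :: "raw_tm \<Rightarrow> raw_tm \<Rightarrow> bool" where
  refl: "tm_eq t t"
| sym: "tm_eq t u \<Longrightarrow> tm_eq u t"
| trans: "tm_eq t u \<Longrightarrow> tm_eq u v \<Longrightarrow> tm_eq t v"
| Lam: "tm_eq t u \<Longrightarrow> tm_eq (RLam x t) (RLam x u)"
| App: "tm_eq t t' \<Longrightarrow> tm_eq u u' \<Longrightarrow> tm_eq (RApp t u) (RApp t' u')"
| alpha: "y |\<notin>| fv_raw_tm t \<Longrightarrow> tm_eq (RLam x t) (RLam y (swap_raw_tm x y t))"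

quotient_type tm = raw_tm / tm_eq
  by (intro equivpI reflpI sympI transpI) (blast intro: tm_eq.intros)+

lift_definition Var :: "tmvar \<Rightarrow> tm" is RVar .
lift_definition Lam :: "tmvar \<Rightarrow> tm \<Rightarrow> tm" is RLam by (rule tm_eq.Lam)
lift_definition App :: "tm \<Rightarrow> tm \<Rightarrow> tm" is RApp by (rule tm_eq.App)

lemma fv_swap_raw_tm: "fv_raw_tm (swap_raw_tm x y t) = transpose x y |`| fv_raw_tm t"
  by (induct t) (simp_all add: fimage_funion swap_fminus)

lift_definition fv :: "tm \<Rightarrow> tmvar fset" is fv_raw_tm
proof -
  fix t u assume "tm_eq t u"
  then show "fv_raw_tm t = fv_raw_tm u"
    by induct (simp_all add: fv_swap_raw_tm fminus_swap)
qed

lemma fv_simps: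
  "fv (Var x) = {|x|}"
  "fv (Lam x t) = fv t |-| {|x|}"
  "fv (App t u) = fv t |\<union>| fv u"
  by (transfer, simp)+


section \<open>Types\<close>

datatype raw_ty =
    RTVar tyvar
  | RTArr raw_ty raw_ty
  | RTAll tyvar raw_ty
  | RTExp evar "tyvar fset" raw_ty

primrec ftv_raw_ty :: "raw_ty \<Rightarrow> tyvar fset" where
  "ftv_raw_ty (RTVar a) = {|a|}"
| "ftv_raw_ty (RTArr T U) = ftv_raw_ty T |\<union>| ftv_raw_ty U"
| "ftv_raw_ty (RTAll a T) = ftv_raw_ty T |-| {|a|}"
| "ftv_raw_ty (RTExp s A T) = ftv_raw_ty T |\<union>| A"

primrec evs_raw_ty :: "raw_ty \<Rightarrow> evar fset" where
  "evs_raw_ty (RTVar a) = {||}"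
| "evs_raw_ty (RTArr T U) = evs_raw_ty T |\<union>| evs_raw_ty U"
| "evs_raw_ty (RTAll a T) = evs_raw_ty T"
| "evs_raw_ty (RTExp s A T) = finsert s (evs_raw_ty T)"

primrec swap_raw_ty :: "tyvar \<Rightarrow> tyvar \<Rightarrow> raw_ty \<Rightarrow> raw_ty" where
  "swap_raw_ty a b (RTVar c) = RTVar (transpose a b c)"
| "swap_raw_ty a b (RTArr T U) = RTArr (swap_raw_ty a b T) (swap_raw_ty a b U)"
| "swap_raw_ty a b (RTAll c T) = RTAll (transpose a b c) (swap_raw_ty a b T)"
| "swap_raw_ty a b (RTExp s A T) = RTExp s (transpose a b |`| A) (swap_raw_ty a b T)"

inductive ty_eq :: "raw_ty \<Rightarrow> raw_ty \<Rightarrow> bool" where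
  refl: "ty_eq T T"
| sym: "ty_eq T U \<Longrightarrow> ty_eq U T"
| trans: "ty_eq T U \<Longrightarrow> ty_eq U V \<Longrightarrow> ty_eq T V"
| Arr: "ty_eq T T' \<Longrightarrow> ty_eq U U' \<Longrightarrow> ty_eq (RTArr T U) (RTArr T' U')"
| All: "ty_eq T U \<Longrightarrow> ty_eq (RTAll a T) (RTAll a U)"
| Exp: "ty_eq T U \<Longrightarrow> ty_eq (RTExp s A T) (RTExp s A U)"
| alpha: "b |\<notin>| ftv_raw_ty T \<Longrightarrow> ty_eq (RTAll a T) (RTAll b (swap_raw_ty a b T))"
| commute: "ty_eq (RTAll a (RTAll b T)) (RTAll b (RTAll a T))"
| vacuous: "a |\<notin>| ftv_raw_ty T \<Longrightarrow> ty_eq (RTAll a T) T"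

quotient_type ty = raw_ty / ty_eq
  by (intro equivpI reflpI sympI transpI) (blast intro: ty_eq.intros)+

lift_definition TVar :: "tyvar \<Rightarrow> ty" is RTVar .
lift_definition TArr :: "ty \<Rightarrow> ty \<Rightarrow> ty" is RTArr by (rule ty_eq.Arr)
lift_definition TAll :: "tyvar \<Rightarrow> ty \<Rightarrow> ty" is RTAll by (rule ty_eq.All)
lift_definition TExp :: "evar \<Rightarrow> tyvar fset \<Rightarrow> ty \<Rightarrow> ty" is RTExp by (rule ty_eq.Exp)

lemma ftv_swap_raw_ty: "ftv_raw_ty (swap_raw_ty a b T) = transpose a b |`| ftv_raw_ty T"
  by (induct T) (simp_all add: fimage_funion swap_fminus)

lemma evs_swap_raw_ty: "evs_raw_ty (swap_raw_ty a b T) = evs_raw_ty T"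
  by (induct T) auto

lemma swap_swap_raw_ty:
  "swap_raw_ty a b (swap_raw_ty c d T) =
    swap_raw_ty (transpose a b c) (transpose a b d) (swap_raw_ty a b T)"
  by (induct T) (auto simp: transpose_conj[of a b c d] fimage_fimage)

lemma swap_raw_ty_commute: "swap_raw_ty a b T = swap_raw_ty b a T"
  by (induct T) (auto simp: transpose_commute)

lemma ftv_raw_ty_eq: "ty_eq T U \<Longrightarrow> ftv_raw_ty T = ftv_raw_ty U"
  by (induct rule: ty_eq.induct)
     (simp_all add: ftv_swap_raw_ty fminus_swap fminus_triv_single fminus_commute)

lemma evs_raw_ty_eq: "ty_eq T U \<Longrightarrow> evs_raw_ty T = evs_raw_ty U"
  by (induct rule: ty_eq.induct) (auto simp: evs_swap_raw_ty)

lift_definition ftv_ty :: "ty \<Rightarrow> tyvar fset" is ftv_raw_ty by (rule ftv_raw_ty_eq)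
lift_definition evs_ty :: "ty \<Rightarrow> evar fset" is evs_raw_ty by (rule evs_raw_ty_eq)

lemma swap_raw_ty_eq: "ty_eq T U \<Longrightarrow> ty_eq (swap_raw_ty a b T) (swap_raw_ty a b U)"
proof (induct rule: ty_eq.induct)
  case (alpha d T c)
  then show ?case
    using ty_eq.alpha[of "transpose a b d" "swap_raw_ty a b T" "transpose a b c"]
    by (simp add: swap_swap_raw_ty[of a b c d] ftv_swap_raw_ty fin_swap)
next
  case (vacuous c T)
  then show ?case
    by (simp add: ty_eq.vacuous ftv_swap_raw_ty fin_swap)
qed (auto intro: ty_eq.intros)

lift_definition swap_ty :: "tyvar \<Rightarrow> tyvar \<Rightarrow> ty \<Rightarrow> ty" is swap_raw_ty
  by (rule swap_raw_ty_eq)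

lemma ftv_ty_simps [simp]:
  "ftv_ty (TVar a) = {|a|}"
  "ftv_ty (TArr T U) = ftv_ty T |\<union>| ftv_ty U"
  "ftv_ty (TAll a T) = ftv_ty T |-| {|a|}"
  "ftv_ty (TExp s A T) = ftv_ty T |\<union>| A"
  by (transfer, simp)+

lemma evs_ty_simps [simp]:
  "evs_ty (TVar a) = {||}"
  "evs_ty (TArr T U) = evs_ty T |\<union>| evs_ty U"
  "evs_ty (TAll a T) = evs_ty T"
  "evs_ty (TExp s A T) = finsert s (evs_ty T)"
  by (transfer, simp)+

lemma swap_ty_simps [simp]:
  "swap_ty a b (TVar c) = TVar (transpose a b c)"
  "swap_ty a b (TArr T U) = TArr (swap_ty a b T) (swap_ty a b U)"
  "swap_ty a b (TAll c T) = TAll (transpose a b c) (swap_ty a b T)"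
  "swap_ty a b (TExp s A T) = TExp s (transpose a b |`| A) (swap_ty a b T)"
  by (transfer, simp add: ty_eq.refl)+

lemma ty_induct [case_names TVar TArr TAll TExp]:
  assumes "\<And>a. P (TVar a)" "\<And>T U. P T \<Longrightarrow> P U \<Longrightarrow> P (TArr T U)"
    "\<And>a T. P T \<Longrightarrow> P (TAll a T)" "\<And>s A T. P T \<Longrightarrow> P (TExp s A T)"
  shows "P T"
proof -
  have "P (abs_ty R)" for R
    by (induct R) (auto simp: assms simp flip: TVar.abs_eq TArr.abs_eq TAll.abs_eq TExp.abs_eq)
  then show ?thesis by (metis ty.abs_induct)
qed

lemma TAll_alpha: "b |\<notin>| ftv_ty T \<Longrightarrow> TAll a T = TAll b (swap_ty a b T)"
  by transfer (rule ty_eq.alpha)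

lemma TAll_commute: "TAll a (TAll b T) = TAll b (TAll a T)"
  by transfer (rule ty_eq.commute)

lemma TAll_vacuous: "a |\<notin>| ftv_ty T \<Longrightarrow> TAll a T = T"
  by transfer (rule ty_eq.vacuous)

lemma ftv_swap_ty: "ftv_ty (swap_ty a b T) = transpose a b |`| ftv_ty T"
  by transfer (rule ftv_swap_raw_ty)

lemma evs_swap_ty [simp]: "evs_ty (swap_ty a b T) = evs_ty T"
  by transfer (rule evs_swap_raw_ty)

lemma swap_ty_commute: "swap_ty a b T = swap_ty b a T"
  by (induct T rule: ty_induct) (auto simp: transpose_commute)

lemma swap_ty_same [simp]: "swap_ty a a T = T"
  by (induct T rule: ty_induct) auto

lemma swap_swap_ty:
  "swap_ty a b (swap_ty c d T) = swap_ty (transpose a b c) (transpose a b d) (swap_ty a b T)"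
  by transfer (subst swap_swap_raw_ty, rule ty_eq.refl)

lemma swap_ty_involutory [simp]: "swap_ty a b (swap_ty a b T) = T"
  by (induct T rule: ty_induct) (auto simp: fimage_fimage)

lemma swap_fset_fresh: "a |\<notin>| A \<Longrightarrow> b |\<notin>| A \<Longrightarrow> transpose a b |`| A = A"
  by (rule fset_eqI, simp only: fin_swap) (metis transpose_apply_other transpose_apply_first transpose_apply_second)

lemma swap_ty_fresh: "a |\<notin>| ftv_ty T \<Longrightarrow> b |\<notin>| ftv_ty T \<Longrightarrow> swap_ty a b T = T"
proof (induct T rule: ty_induct)
  case (TAll c T)
  show ?case
  proof (cases "c = a \<or> c = b")
    case True
    define d where "d = (if c = a then b else a)"
    have sw: "swap_ty a b T = swap_ty c d T" "transpose a b c = d"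
      using True by (auto simp: d_def swap_ty_commute)
    have "d |\<notin>| ftv_ty T \<or> d = c" using True TAll.prems by (auto simp: d_def)
    then have "TAll c T = TAll d (swap_ty c d T)"
      using TAll_alpha[of d T c] by (auto simp: swap_ty_same)
    then show ?thesis unfolding swap_ty_simps sw by simp
  next
    case False
    with TAll have "swap_ty a b T = T" by auto
    with False show ?thesis by simp
  qed
qed (auto simp: swap_fset_fresh)


section \<open>Expansions, environments and substitutions\<close>

datatype expn =
    Eps
  | EAll tyvar expn
  | EExp evar "tyvar fset" expn
  | ECo expn ty

primrec ftv_expn :: "expn \<Rightarrow> tyvar fset" where
  "ftv_expn Eps = {||}"
| "ftv_expn (EAll a E) = finsert a (ftv_expn E)"
| "ftv_expn (EExp s A E) = ftv_expn E |\<union>| A"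
| "ftv_expn (ECo E T) = ftv_expn E |\<union>| ftv_ty T"

primrec expand_ty :: "expn \<Rightarrow> tyvar fset \<Rightarrow> ty \<Rightarrow> ty" where
  "expand_ty Eps A X = X"
| "expand_ty (EAll a E) A X = (if a |\<notin>| A then TAll a (expand_ty E A X) else expand_ty E A X)"
| "expand_ty (EExp s A' E) A X = TExp s (A |\<union>| A') (expand_ty E A X)"
| "expand_ty (ECo E T) A X = T"

type_synonym env = "(tmvar, ty) fmap"

abbreviation ftv_env :: "env \<Rightarrow> tyvar fset" where
  "ftv_env \<Gamma> \<equiv> fUnions ftv_ty (fmran \<Gamma>)"

abbreviation evs_env :: "env \<Rightarrow> evar fset" where
  "evs_env \<Gamma> \<equiv> fUnions evs_ty (fmran \<Gamma>)"

datatype subst =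
    SNil
  | STy tyvar ty subst
  | SEv evar expn subst

primrec ftv_subst :: "subst \<Rightarrow> tyvar fset" where
  "ftv_subst SNil = {||}"
| "ftv_subst (STy a T \<sigma>) = finsert a (ftv_ty T) |\<union>| ftv_subst \<sigma>"
| "ftv_subst (SEv s E \<sigma>) = ftv_expn E |\<union>| ftv_subst \<sigma>"

primrec subst_tyvar :: "subst \<Rightarrow> tyvar \<Rightarrow> ty" where
  "subst_tyvar SNil a = TVar a"
| "subst_tyvar (STy b T \<sigma>) a = (if a = b then T else subst_tyvar \<sigma> a)"
| "subst_tyvar (SEv s E \<sigma>) a = subst_tyvar \<sigma> a"

primrec subst_evar :: "subst \<Rightarrow> evar \<Rightarrow> expn" where
  "subst_evar SNil s = EExp s {||} Eps"
| "subst_evar (STy b T \<sigma>) s = subst_evar \<sigma> s"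
| "subst_evar (SEv s' E \<sigma>) s = (if s = s' then E else subst_evar \<sigma> s)"

abbreviation ftv_subst_image :: "subst \<Rightarrow> tyvar fset \<Rightarrow> tyvar fset" where
  "ftv_subst_image \<sigma> A \<equiv> fUnions (\<lambda>a. ftv_ty (subst_tyvar \<sigma> a)) A"

text \<open>
  Substitution is first defined on raw syntax for an arbitrary pair of maps \<open>\<theta>\<close>, \<open>\<eta>\<close>
  on type and expansion variables: a bound variable is replaced by a name that does not occur
  free in the images of the free variables of the body.  The substitution clauses for
  \<open>[\<sigma>]T\<close> and \<open>[\<sigma>]Q\<close> are then the lemmas \<open>subst_ty_simps\<close> and
  \<open>subst_skel_simps\<close> below.
\<close>

definition fresh :: "tyvar fset \<Rightarrow> tyvar" where
  "fresh A = (SOME a. a |\<notin>| A)"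

definition image_ftv :: "(tyvar \<Rightarrow> ty) \<Rightarrow> (evar \<Rightarrow> expn) \<Rightarrow> tyvar fset \<Rightarrow> evar fset \<Rightarrow> tyvar fset" where
  "image_ftv \<theta> \<eta> A S = fUnions (\<lambda>a. ftv_ty (\<theta> a)) A |\<union>| fUnions (\<lambda>s. ftv_expn (\<eta> s)) S"

primrec psubst_raw_ty :: "(evar \<Rightarrow> expn) \<Rightarrow> raw_ty \<Rightarrow> (tyvar \<Rightarrow> ty) \<Rightarrow> ty" where
  "psubst_raw_ty \<eta> (RTVar a) \<theta> = \<theta> a"
| "psubst_raw_ty \<eta> (RTArr T U) \<theta> = TArr (psubst_raw_ty \<eta> T \<theta>) (psubst_raw_ty \<eta> U \<theta>)"
| "psubst_raw_ty \<eta> (RTAll a T) \<theta> =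
    (let b = fresh (image_ftv \<theta> \<eta> (ftv_raw_ty T |-| {|a|}) (evs_raw_ty T))
     in TAll b (psubst_raw_ty \<eta> T (\<theta>(a := TVar b))))"
| "psubst_raw_ty \<eta> (RTExp s A T) \<theta> =
    expand_ty (\<eta> s) (fUnions (\<lambda>a. ftv_ty (\<theta> a)) A) (psubst_raw_ty \<eta> T \<theta>)"

lemma fresh: "fresh A |\<notin>| A"
proof -
  have "inj TyVar" by (simp add: inj_def)
  then have "infinite (UNIV :: tyvar set)"
    by (metis finite_imageD finite_subset infinite_UNIV_nat subset_UNIV)
  then have "\<exists>a. a |\<notin>| A" by (metis ex_new_if_finite finite_fset)
  then show ?thesis unfolding fresh_def by (rule someI_ex)
qed

lemma in_image_ftv:
  "c |\<in>| image_ftv \<theta> \<eta> A S \<longleftrightarrow>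
    (\<exists>a. a |\<in>| A \<and> c |\<in>| ftv_ty (\<theta> a)) \<or> (\<exists>s. s |\<in>| S \<and> c |\<in>| ftv_expn (\<eta> s))"
  by (simp add: image_ftv_def)

lemma image_ftv_cong:
  "(\<And>a. a |\<in>| A \<Longrightarrow> \<theta> a = \<theta>' a) \<Longrightarrow> image_ftv \<theta> \<eta> A S = image_ftv \<theta>' \<eta> A S"
  by (rule fset_eqI) (simp add: in_image_ftv cong: conj_cong)

lemma ftv_expand_ty: "ftv_ty (expand_ty E A T) |\<subseteq>| ftv_expn E |\<union>| A |\<union>| ftv_ty T"
  by (induct E) auto

lemma swap_expand_ty:
  "a |\<notin>| ftv_expn E \<Longrightarrow> b |\<notin>| ftv_expn E \<Longrightarrow>
    swap_ty a b (expand_ty E A T) = expand_ty E (transpose a b |`| A) (swap_ty a b T)"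
  by (induct E) (auto simp: swap_ty_fresh fimage_funion swap_fset_fresh fin_swap)

lemma psubst_raw_ty_cong:
  "(\<And>a. a |\<in>| ftv_raw_ty T \<Longrightarrow> \<theta> a = \<theta>' a) \<Longrightarrow> psubst_raw_ty \<eta> T \<theta> = psubst_raw_ty \<eta> T \<theta>'"
proof (induct T arbitrary: \<theta> \<theta>')
  case (RTArr T U)
  have "psubst_raw_ty \<eta> T \<theta> = psubst_raw_ty \<eta> T \<theta>'" "psubst_raw_ty \<eta> U \<theta> = psubst_raw_ty \<eta> U \<theta>'"
    by (rule RTArr(1) RTArr(2), simp add: RTArr(3))+
  then show ?case by simp
next
  case (RTAll a T)
  have "image_ftv \<theta> \<eta> (ftv_raw_ty T |-| {|a|}) (evs_raw_ty T) =
      image_ftv \<theta>' \<eta> (ftv_raw_ty T |-| {|a|}) (evs_raw_ty T)"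
    by (rule image_ftv_cong) (simp add: RTAll(2))
  moreover have "psubst_raw_ty \<eta> T (\<theta>(a := TVar b)) = psubst_raw_ty \<eta> T (\<theta>'(a := TVar b))" for b
    by (rule RTAll(1)) (simp add: RTAll(2))
  ultimately show ?case by (simp add: Let_def)
next
  case (RTExp s A T)
  have "fUnions (\<lambda>a. ftv_ty (\<theta> a)) A = fUnions (\<lambda>a. ftv_ty (\<theta>' a)) A"
    by (intro arg_cong[of _ _ ffUnion] fimage_cong) (simp_all add: RTExp(2))
  moreover have "psubst_raw_ty \<eta> T \<theta> = psubst_raw_ty \<eta> T \<theta>'"
    by (rule RTExp(1)) (simp add: RTExp(2))
  ultimately show ?case by simp
qed simp

lemma ftv_psubst_raw_ty:
  "ftv_ty (psubst_raw_ty \<eta> T \<theta>) |\<subseteq>| image_ftv \<theta> \<eta> (ftv_raw_ty T) (evs_raw_ty T)"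
proof (induct T arbitrary: \<theta>)
  case (RTArr T1 T2)
  then show ?case by (fastforce simp: in_image_ftv fsubset_iff)
next
  case (RTAll a T)
  define b where "b = fresh (image_ftv \<theta> \<eta> (ftv_raw_ty T |-| {|a|}) (evs_raw_ty T))"
  have "ftv_ty (psubst_raw_ty \<eta> T (\<theta>(a := TVar b))) |\<subseteq>|
      image_ftv (\<theta>(a := TVar b)) \<eta> (ftv_raw_ty T) (evs_raw_ty T)"
    by (rule RTAll)
  then show ?case
    by (auto simp: Let_def b_def[symmetric] in_image_ftv fsubset_iff split: if_splits)
next
  case (RTExp s A T)
  have "ftv_ty (psubst_raw_ty \<eta> (RTExp s A T) \<theta>) |\<subseteq>|
     ftv_expn (\<eta> s) |\<union>| fUnions (\<lambda>a. ftv_ty (\<theta> a)) A |\<union>| ftv_ty (psubst_raw_ty \<eta> T \<theta>)"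
    by (simp add: ftv_expand_ty)
  with RTExp[of \<theta>] show ?case
    by (fastforce simp: in_image_ftv fsubset_iff)
qed (auto simp: in_image_ftv)

lemma psubst_raw_ty_swap:
  "psubst_raw_ty \<eta> (swap_raw_ty a b T) \<theta> = psubst_raw_ty \<eta> T (\<theta> \<circ> transpose a b)"
proof (induct T arbitrary: \<theta>)
  case (RTAll c T)
  have "image_ftv \<theta> \<eta> (ftv_raw_ty (swap_raw_ty a b T) |-| {|transpose a b c|}) S =
        image_ftv (\<theta> \<circ> transpose a b) \<eta> (ftv_raw_ty T |-| {|c|}) S" for S
    by (simp add: fset_eq_iff in_image_ftv ftv_swap_raw_ty fin_swap)
      (metis transpose_involutory)
  moreover have "\<theta>(transpose a b c := X) \<circ> transpose a b = (\<theta> \<circ> transpose a b)(c := X)" for X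
    by (auto simp: fun_eq_iff transpose_eq_iff)
  ultimately show ?case 
    by (simp only: swap_raw_ty.simps psubst_raw_ty.simps RTAll evs_swap_raw_ty Let_def)
next
  case (RTExp s A T)
  then show ?case by (simp add: fimage_fimage o_def)
qed auto

lemma psubst_raw_ty_rename:
  assumes swp: "\<And>c d \<theta>. c |\<notin>| fUnions (\<lambda>s. ftv_expn (\<eta> s)) (evs_raw_ty T) \<Longrightarrow>
      d |\<notin>| fUnions (\<lambda>s. ftv_expn (\<eta> s)) (evs_raw_ty T) \<Longrightarrow>
      swap_ty c d (psubst_raw_ty \<eta> T \<theta>) = psubst_raw_ty \<eta> T (swap_ty c d \<circ> \<theta>)"
    and b: "b |\<notin>| image_ftv \<theta> \<eta> (ftv_raw_ty T |-| {|a|}) (evs_raw_ty T)"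
    and b': "b' |\<notin>| image_ftv \<theta> \<eta> (ftv_raw_ty T |-| {|a|}) (evs_raw_ty T)"
  shows "TAll b (psubst_raw_ty \<eta> T (\<theta>(a := TVar b))) = TAll b' (psubst_raw_ty \<eta> T (\<theta>(a := TVar b')))"
proof (cases "b = b'")
  case False
  have "b' |\<notin>| ftv_ty (psubst_raw_ty \<eta> T (\<theta>(a := TVar b)))"
  proof
    assume "b' |\<in>| ftv_ty (psubst_raw_ty \<eta> T (\<theta>(a := TVar b)))"
    then have "b' |\<in>| image_ftv (\<theta>(a := TVar b)) \<eta> (ftv_raw_ty T) (evs_raw_ty T)"
      using ftv_psubst_raw_ty by blast
    with b' False show False by (auto simp: in_image_ftv split: if_splits)
  qed
  then have "TAll b (psubst_raw_ty \<eta> T (\<theta>(a := TVar b))) =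
      TAll b' (swap_ty b b' (psubst_raw_ty \<eta> T (\<theta>(a := TVar b))))"
    by (rule TAll_alpha)
  also have "swap_ty b b' (psubst_raw_ty \<eta> T (\<theta>(a := TVar b))) =
      psubst_raw_ty \<eta> T (swap_ty b b' \<circ> \<theta>(a := TVar b))"
    using b b' by (intro swp) (auto simp: in_image_ftv)
  also have "\<dots> = psubst_raw_ty \<eta> T (\<theta>(a := TVar b'))"
  proof (rule psubst_raw_ty_cong)
    fix c assume "c |\<in>| ftv_raw_ty T"
    then show "(swap_ty b b' \<circ> \<theta>(a := TVar b)) c = (\<theta>(a := TVar b')) c"
      using b b' by (auto simp: in_image_ftv intro!: swap_ty_fresh)
  qed
  finally show ?thesis .
qed simp

lemma image_ftv_swap:
  assumes "c |\<notin>| fUnions (\<lambda>s. ftv_expn (\<eta> s)) S" "d |\<notin>| fUnions (\<lambda>s. ftv_expn (\<eta> s)) S"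
    and "b |\<notin>| image_ftv \<theta> \<eta> A S"
  shows "transpose c d b |\<notin>| image_ftv (swap_ty c d \<circ> \<theta>) \<eta> A S"
proof
  assume "transpose c d b |\<in>| image_ftv (swap_ty c d \<circ> \<theta>) \<eta> A S"
  then consider x where "x |\<in>| A" "b |\<in>| ftv_ty (\<theta> x)"
    | s where "s |\<in>| S" "transpose c d b |\<in>| ftv_expn (\<eta> s)"
    unfolding in_image_ftv by (auto simp: ftv_swap_ty fin_swap)
  then have "b |\<in>| image_ftv \<theta> \<eta> A S"
  proof cases
    case 1
    then show ?thesis by (auto simp: in_image_ftv)
  next
    case 2
    with assms(1,2) have "b |\<in>| ftv_expn (\<eta> s)"
      unfolding fUnions_iff by (metis transpose_apply_other transpose_apply_first transpose_apply_second)
    with 2 show ?thesis by (auto simp: in_image_ftv)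
  qed
  with assms(3) show False by contradiction
qed

lemma psubst_raw_ty_swap_image:
  assumes "c |\<notin>| fUnions (\<lambda>s. ftv_expn (\<eta> s)) (evs_raw_ty T)"
    and "d |\<notin>| fUnions (\<lambda>s. ftv_expn (\<eta> s)) (evs_raw_ty T)"
  shows "swap_ty c d (psubst_raw_ty \<eta> T \<theta>) = psubst_raw_ty \<eta> T (swap_ty c d \<circ> \<theta>)"
  using assms
proof (induct T arbitrary: c d \<theta>)
  case (RTAll a T)
  define F where "F = image_ftv \<theta> \<eta> (ftv_raw_ty T |-| {|a|}) (evs_raw_ty T)"
  define G where "G = image_ftv (swap_ty c d \<circ> \<theta>) \<eta> (ftv_raw_ty T |-| {|a|}) (evs_raw_ty T)"
  define b where "b = fresh F"
  have "transpose c d b |\<notin>| G"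
    unfolding G_def b_def using RTAll(2,3) fresh[of F]
    by (intro image_ftv_swap) (auto simp: F_def)
  then have "TAll (transpose c d b) (psubst_raw_ty \<eta> T ((swap_ty c d \<circ> \<theta>)(a := TVar (transpose c d b))))
      = TAll (fresh G) (psubst_raw_ty \<eta> T ((swap_ty c d \<circ> \<theta>)(a := TVar (fresh G))))"
    using fresh[of G] unfolding G_def by (intro psubst_raw_ty_rename RTAll(1))
  moreover have "swap_ty c d (psubst_raw_ty \<eta> T (\<theta>(a := TVar b))) =
      psubst_raw_ty \<eta> T (swap_ty c d \<circ> \<theta>(a := TVar b))"
    using RTAll(2,3) by (intro RTAll(1)) simp_all
  moreover have "swap_ty c d \<circ> \<theta>(a := TVar b) = (swap_ty c d \<circ> \<theta>)(a := TVar (transpose c d b))"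
    by (auto simp: fun_eq_iff)
  ultimately show ?case
    by (simp only: psubst_raw_ty.simps Let_def swap_ty_simps F_def[symmetric] G_def[symmetric]
        b_def[symmetric])
next
  case (RTExp s A T)
  have "transpose c d |`| fUnions (\<lambda>a. ftv_ty (\<theta> a)) A = fUnions (\<lambda>a. ftv_ty ((swap_ty c d \<circ> \<theta>) a)) A"
    by (rule fset_eqI) (simp only: fin_transpose_image fUnions_iff o_def ftv_swap_ty)
  moreover have "swap_ty c d (psubst_raw_ty \<eta> T \<theta>) = psubst_raw_ty \<eta> T (swap_ty c d \<circ> \<theta>)"
    using RTExp(2,3) by (intro RTExp(1)) (simp_all add: fUnions_iff)
  ultimately show ?case using RTExp(2,3) by (simp add: swap_expand_ty o_def)
next
  case (RTArr T U)
  have "swap_ty c d (psubst_raw_ty \<eta> T \<theta>) = psubst_raw_ty \<eta> T (swap_ty c d \<circ> \<theta>)"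
    using RTArr(3,4) by (intro RTArr(1)) auto
  moreover have "swap_ty c d (psubst_raw_ty \<eta> U \<theta>) = psubst_raw_ty \<eta> U (swap_ty c d \<circ> \<theta>)"
    using RTArr(3,4) by (intro RTArr(2)) auto
  ultimately show ?case by (simp add: o_def)
qed simp

lemma psubst_raw_ty_All:
  assumes "b |\<notin>| image_ftv \<theta> \<eta> (ftv_raw_ty T |-| {|a|}) (evs_raw_ty T)"
  shows "psubst_raw_ty \<eta> (RTAll a T) \<theta> = TAll b (psubst_raw_ty \<eta> T (\<theta>(a := TVar b)))"
  unfolding psubst_raw_ty.simps Let_def
  by (intro psubst_raw_ty_rename psubst_raw_ty_swap_image fresh assms)

lemma psubst_raw_ty_eq: "ty_eq T U \<Longrightarrow> psubst_raw_ty \<eta> T \<theta> = psubst_raw_ty \<eta> U \<theta>"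
proof (induct arbitrary: \<theta> rule: ty_eq.induct)
  case (All T U a)
  show ?case
    by (simp only: psubst_raw_ty.simps ftv_raw_ty_eq[OF All(1)] evs_raw_ty_eq[OF All(1)] All(2))
next
  case (alpha b T a)
  define c where "c = fresh (image_ftv \<theta> \<eta> (ftv_raw_ty T |-| {|a|}) (evs_raw_ty T))"
  have "psubst_raw_ty \<eta> (swap_raw_ty a b T) (\<theta>(b := TVar c)) = psubst_raw_ty \<eta> T (\<theta>(a := TVar c))"
    unfolding psubst_raw_ty_swap
  proof (rule psubst_raw_ty_cong)
    fix x assume "x |\<in>| ftv_raw_ty T"
    with alpha show "(\<theta>(b := TVar c) \<circ> transpose a b) x = (\<theta>(a := TVar c)) x"
      by (cases "x = a"; cases "x = b") auto
  qed
  then show ?case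
    by (simp add: Let_def ftv_swap_raw_ty evs_swap_raw_ty fminus_swap[OF alpha] c_def)
next
  case (commute a b T)
  show ?case
  proof (cases "a = b")
    case False
    define I where "I = image_ftv \<theta> \<eta> (ftv_raw_ty T |-| {|a|} |-| {|b|}) (evs_raw_ty T)"
    define c where "c = fresh I"
    define d where "d = fresh (finsert c I)"
    have cd: "c |\<notin>| I" "d |\<notin>| I" "c \<noteq> d"
      using fresh[of I] fresh[of "finsert c I"] by (auto simp: c_def d_def)
    have upd: "x |\<notin>| image_ftv (\<theta>(y := TVar z)) \<eta> (ftv_raw_ty T |-| {|w|}) (evs_raw_ty T)"
      if "x |\<notin>| I" "x \<noteq> z" "{y, w} = {a, b}" for x y z w
      using that unfolding I_def by (auto simp: in_image_ftv doubleton_eq_iff)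
    have "psubst_raw_ty \<eta> (RTAll a (RTAll b T)) \<theta> = TAll c (psubst_raw_ty \<eta> (RTAll b T) (\<theta>(a := TVar c)))"
      using cd by (intro psubst_raw_ty_All) (simp add: I_def fminus_commute)
    also have "psubst_raw_ty \<eta> (RTAll b T) (\<theta>(a := TVar c)) =
        TAll d (psubst_raw_ty \<eta> T (\<theta>(a := TVar c, b := TVar d)))"
      using cd by (intro psubst_raw_ty_All upd) auto
    finally have 1: "psubst_raw_ty \<eta> (RTAll a (RTAll b T)) \<theta> =
        TAll c (TAll d (psubst_raw_ty \<eta> T (\<theta>(a := TVar c, b := TVar d))))" .
    have "psubst_raw_ty \<eta> (RTAll b (RTAll a T)) \<theta> = TAll d (psubst_raw_ty \<eta> (RTAll a T) (\<theta>(b := TVar d)))"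
      using cd by (intro psubst_raw_ty_All) (simp add: I_def)
    also have "psubst_raw_ty \<eta> (RTAll a T) (\<theta>(b := TVar d)) =
        TAll c (psubst_raw_ty \<eta> T (\<theta>(b := TVar d, a := TVar c)))"
      using cd by (intro psubst_raw_ty_All upd) auto
    finally show ?thesis
      unfolding 1 by (simp only: TAll_commute[of c d] fun_upd_twist[OF False])
  qed simp
next
  case (vacuous a T)
  define b where "b = fresh (image_ftv \<theta> \<eta> (ftv_raw_ty T |-| {|a|}) (evs_raw_ty T))"
  have "psubst_raw_ty \<eta> T (\<theta>(a := TVar b)) = psubst_raw_ty \<eta> T \<theta>"
    using vacuous by (intro psubst_raw_ty_cong) auto
  moreover have "b |\<notin>| ftv_ty (psubst_raw_ty \<eta> T \<theta>)"
    using ftv_psubst_raw_ty[of \<eta> T \<theta>] fresh vacuous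
    by (metis b_def fminus_triv_single fsubsetD)
  ultimately show ?case
    by (simp only: psubst_raw_ty.simps Let_def b_def[symmetric] TAll_vacuous simp_thms)
qed simp_all

definition psubst_ty :: "(evar \<Rightarrow> expn) \<Rightarrow> ty \<Rightarrow> (tyvar \<Rightarrow> ty) \<Rightarrow> ty" where
  "psubst_ty \<eta> T \<theta> = psubst_raw_ty \<eta> (rep_ty T) \<theta>"

lemma psubst_ty_abs: "psubst_ty \<eta> (abs_ty R) \<theta> = psubst_raw_ty \<eta> R \<theta>"
  unfolding psubst_ty_def
  by (rule psubst_raw_ty_eq) (metis Quotient3_abs_rep Quotient3_ty ty.abs_eq_iff)

lemma psubst_ty_simps:
  "psubst_ty \<eta> (TVar a) \<theta> = \<theta> a"
  "psubst_ty \<eta> (TArr T U) \<theta> = TArr (psubst_ty \<eta> T \<theta>) (psubst_ty \<eta> U \<theta>)"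
  "psubst_ty \<eta> (TExp s A T) \<theta> =
    expand_ty (\<eta> s) (fUnions (\<lambda>a. ftv_ty (\<theta> a)) A) (psubst_ty \<eta> T \<theta>)"
  "b |\<notin>| image_ftv \<theta> \<eta> (ftv_ty T |-| {|a|}) (evs_ty T) \<Longrightarrow>
    psubst_ty \<eta> (TAll a T) \<theta> = TAll b (psubst_ty \<eta> T (\<theta>(a := TVar b)))"
     apply (simp add: TVar.abs_eq psubst_ty_abs)
    apply (induct T rule: ty.abs_induct, induct U rule: ty.abs_induct,
      simp add: TArr.abs_eq psubst_ty_abs)
   apply (induct T rule: ty.abs_induct, simp add: TExp.abs_eq psubst_ty_abs)
  apply (induct T rule: ty.abs_induct,
      simp only: TAll.abs_eq psubst_ty_abs ftv_ty.abs_eq evs_ty.abs_eq psubst_raw_ty_All)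
  done

lemma psubst_ty_cong:
  "(\<And>a. a |\<in>| ftv_ty T \<Longrightarrow> \<theta> a = \<theta>' a) \<Longrightarrow> psubst_ty \<eta> T \<theta> = psubst_ty \<eta> T \<theta>'"
proof (induct T rule: ty.abs_induct)
  case (1 R)
  then show ?case unfolding psubst_ty_abs ftv_ty.abs_eq by (rule psubst_raw_ty_cong)
qed

lemma ftv_psubst_ty: "ftv_ty (psubst_ty \<eta> T \<theta>) |\<subseteq>| image_ftv \<theta> \<eta> (ftv_ty T) (evs_ty T)"
  by (induct T rule: ty.abs_induct)
    (simp only: psubst_ty_abs ftv_ty.abs_eq evs_ty.abs_eq ftv_psubst_raw_ty)

lemma psubst_ty_swap: "psubst_ty \<eta> (swap_ty a b T) \<theta> = psubst_ty \<eta> T (\<theta> \<circ> transpose a b)"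
  by (induct T rule: ty.abs_induct) (simp only: psubst_ty_abs swap_ty.abs_eq psubst_raw_ty_swap)

lemma psubst_ty_swap_image:
  "c |\<notin>| fUnions (\<lambda>s. ftv_expn (\<eta> s)) (evs_ty T) \<Longrightarrow>
    d |\<notin>| fUnions (\<lambda>s. ftv_expn (\<eta> s)) (evs_ty T) \<Longrightarrow>
    swap_ty c d (psubst_ty \<eta> T \<theta>) = psubst_ty \<eta> T (swap_ty c d \<circ> \<theta>)"
  by (induct T rule: ty.abs_induct)
    (simp only: psubst_ty_abs evs_ty.abs_eq, rule psubst_raw_ty_swap_image)

definition subst_ty :: "subst \<Rightarrow> ty \<Rightarrow> ty" where
  "subst_ty \<sigma> T = psubst_ty (subst_evar \<sigma>) T (subst_tyvar \<sigma>)"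

lemma ftv_subst_tyvar: "ftv_ty (subst_tyvar \<sigma> a) |\<subseteq>| finsert a (ftv_subst \<sigma>)"
  by (induct \<sigma>) auto

lemma ftv_subst_evar: "ftv_expn (subst_evar \<sigma> s) |\<subseteq>| ftv_subst \<sigma>"
  by (induct \<sigma>) auto

lemma subst_tyvar_fresh: "a |\<notin>| ftv_subst \<sigma> \<Longrightarrow> subst_tyvar \<sigma> a = TVar a"
  by (induct \<sigma>) auto

lemma subst_tyvar_upd: "a |\<notin>| ftv_subst \<sigma> \<Longrightarrow> (subst_tyvar \<sigma>)(a := TVar a) = subst_tyvar \<sigma>"
  by (metis fun_upd_triv subst_tyvar_fresh)

lemma image_ftv_subst_fresh:
  "a |\<notin>| ftv_subst \<sigma> \<Longrightarrow> a |\<notin>| image_ftv (subst_tyvar \<sigma>) (subst_evar \<sigma>) (A |-| {|a|}) S"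
  using ftv_subst_tyvar ftv_subst_evar by (fastforce simp: in_image_ftv)

lemma subst_ty_simps:
  "subst_ty \<sigma> (TVar a) = subst_tyvar \<sigma> a"
  "subst_ty \<sigma> (TArr T U) = TArr (subst_ty \<sigma> T) (subst_ty \<sigma> U)"
  "a |\<notin>| ftv_subst \<sigma> \<Longrightarrow> subst_ty \<sigma> (TAll a T) = TAll a (subst_ty \<sigma> T)"
  "subst_ty \<sigma> (TExp s A T) = expand_ty (subst_evar \<sigma> s) (ftv_subst_image \<sigma> A) (subst_ty \<sigma> T)"
     apply (simp add: subst_ty_def psubst_ty_simps(1))
    apply (simp add: subst_ty_def psubst_ty_simps(2))
   apply (simp only: subst_ty_def psubst_ty_simps(4)[OF image_ftv_subst_fresh] subst_tyvar_upd simp_thms)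
  apply (simp add: subst_ty_def psubst_ty_simps(3))
  done

abbreviation subst_env :: "subst \<Rightarrow> env \<Rightarrow> env" where
  "subst_env \<sigma> \<equiv> fmmap (subst_ty \<sigma>)"


section \<open>Constraints\<close>

datatype raw_constr =
    ROmega
  | RLeq ty ty
  | RConj raw_constr raw_constr
  | REx tyvar raw_constr
  | RCExp evar "tyvar fset" ty raw_constr

primrec ftv_raw_constr :: "raw_constr \<Rightarrow> tyvar fset" where
  "ftv_raw_constr ROmega = {||}"
| "ftv_raw_constr (RLeq T U) = ftv_ty T |\<union>| ftv_ty U"
| "ftv_raw_constr (RConj C D) = ftv_raw_constr C |\<union>| ftv_raw_constr D"
| "ftv_raw_constr (REx a C) = ftv_raw_constr C |-| {|a|}"
| "ftv_raw_constr (RCExp s A T C) = ftv_raw_constr C |\<union>| A |\<union>| ftv_ty T"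

primrec swap_raw_constr :: "tyvar \<Rightarrow> tyvar \<Rightarrow> raw_constr \<Rightarrow> raw_constr" where
  "swap_raw_constr a b ROmega = ROmega"
| "swap_raw_constr a b (RLeq T U) = RLeq (swap_ty a b T) (swap_ty a b U)"
| "swap_raw_constr a b (RConj C D) = RConj (swap_raw_constr a b C) (swap_raw_constr a b D)"
| "swap_raw_constr a b (REx c C) = REx (transpose a b c) (swap_raw_constr a b C)"
| "swap_raw_constr a b (RCExp s A T C) =
    RCExp s (transpose a b |`| A) (swap_ty a b T) (swap_raw_constr a b C)"

inductive constr_eq :: "raw_constr \<Rightarrow> raw_constr \<Rightarrow> bool" where
  refl: "constr_eq C C"
| sym: "constr_eq C D \<Longrightarrow> constr_eq D C"
| trans: "constr_eq C D \<Longrightarrow> constr_eq D E \<Longrightarrow> constr_eq C E"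
| Conj: "constr_eq C C' \<Longrightarrow> constr_eq D D' \<Longrightarrow> constr_eq (RConj C D) (RConj C' D')"
| Ex: "constr_eq C D \<Longrightarrow> constr_eq (REx a C) (REx a D)"
| CExp: "constr_eq C D \<Longrightarrow> constr_eq (RCExp s A T C) (RCExp s A T D)"
| alpha: "b |\<notin>| ftv_raw_constr C \<Longrightarrow> constr_eq (REx a C) (REx b (swap_raw_constr a b C))"
| assoc: "constr_eq (RConj (RConj C D) E) (RConj C (RConj D E))"
| comm: "constr_eq (RConj C D) (RConj D C)"
| idem: "constr_eq (RConj C C) C"
| unit: "constr_eq (RConj C ROmega) C"
| Ex_Conj: "constr_eq (REx a (RConj C D)) (RConj (REx a C) (REx a D))"
| CExp_Conj: "constr_eq (RCExp s A T (RConj C D)) (RConj (RCExp s A T C) (RCExp s A T D))"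
| vacuous: "a |\<notin>| ftv_raw_constr C \<Longrightarrow> constr_eq (REx a C) C"

quotient_type constr = raw_constr / constr_eq
  by (intro equivpI reflpI sympI transpI) (blast intro: constr_eq.intros)+

lift_definition Omega :: constr is ROmega .
lift_definition Leq :: "ty \<Rightarrow> ty \<Rightarrow> constr" (infix "\<lessdot>" 55) is RLeq .
lift_definition Conj :: "constr \<Rightarrow> constr \<Rightarrow> constr" (infixl "\<^bold>\<and>" 50) is RConj by (rule constr_eq.Conj)
lift_definition CEx :: "tyvar \<Rightarrow> constr \<Rightarrow> constr" is REx by (rule constr_eq.Ex)
lift_definition CExp :: "evar \<Rightarrow> tyvar fset \<Rightarrow> ty \<Rightarrow> constr \<Rightarrow> constr" is RCExp by (rule constr_eq.CExp)

inductive reflexive_constr :: "constr \<Rightarrow> bool" where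
  "reflexive_constr Omega"
| "reflexive_constr (T \<lessdot> T)"
| "reflexive_constr C \<Longrightarrow> reflexive_constr (CEx a C)"
| "reflexive_constr C \<Longrightarrow> reflexive_constr (CExp s A T C)"
| "reflexive_constr C1 \<Longrightarrow> reflexive_constr C2 \<Longrightarrow> reflexive_constr (C1 \<^bold>\<and> C2)"


section \<open>Skeletons\<close>

datatype raw_skel =
    RSVar tmvar env
  | RSLam tmvar raw_skel
  | RSApp raw_skel raw_skel
  | RSAll tyvar raw_skel
  | RSExp evar "tyvar fset" raw_skel
  | RSCo raw_skel ty

definition swap_dom :: "tmvar \<Rightarrow> tmvar \<Rightarrow> env \<Rightarrow> env" where
  "swap_dom x y \<Gamma> = Abs_fmap (fmlookup \<Gamma> \<circ> transpose x y)"

primrec fv_raw_skel :: "raw_skel \<Rightarrow> tmvar fset" where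
  "fv_raw_skel (RSVar x \<Gamma>) = finsert x (fmdom \<Gamma>)"
| "fv_raw_skel (RSLam x Q) = fv_raw_skel Q |-| {|x|}"
| "fv_raw_skel (RSApp Q R) = fv_raw_skel Q |\<union>| fv_raw_skel R"
| "fv_raw_skel (RSAll a Q) = fv_raw_skel Q"
| "fv_raw_skel (RSExp s A Q) = fv_raw_skel Q"
| "fv_raw_skel (RSCo Q T) = fv_raw_skel Q"

primrec ftv_raw_skel :: "raw_skel \<Rightarrow> tyvar fset" where
  "ftv_raw_skel (RSVar x \<Gamma>) = ftv_env \<Gamma>"
| "ftv_raw_skel (RSLam x Q) = ftv_raw_skel Q"
| "ftv_raw_skel (RSApp Q R) = ftv_raw_skel Q |\<union>| ftv_raw_skel R"
| "ftv_raw_skel (RSAll a Q) = ftv_raw_skel Q |-| {|a|}"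
| "ftv_raw_skel (RSExp s A Q) = ftv_raw_skel Q |\<union>| A"
| "ftv_raw_skel (RSCo Q T) = ftv_raw_skel Q |\<union>| ftv_ty T"

primrec evs_raw_skel :: "raw_skel \<Rightarrow> evar fset" where
  "evs_raw_skel (RSVar x \<Gamma>) = evs_env \<Gamma>"
| "evs_raw_skel (RSLam x Q) = evs_raw_skel Q"
| "evs_raw_skel (RSApp Q R) = evs_raw_skel Q |\<union>| evs_raw_skel R"
| "evs_raw_skel (RSAll a Q) = evs_raw_skel Q"
| "evs_raw_skel (RSExp s A Q) = finsert s (evs_raw_skel Q)"
| "evs_raw_skel (RSCo Q T) = evs_raw_skel Q |\<union>| evs_ty T"

primrec swap_tm_raw_skel :: "tmvar \<Rightarrow> tmvar \<Rightarrow> raw_skel \<Rightarrow> raw_skel" where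
  "swap_tm_raw_skel x y (RSVar z \<Gamma>) = RSVar (transpose x y z) (swap_dom x y \<Gamma>)"
| "swap_tm_raw_skel x y (RSLam z Q) = RSLam (transpose x y z) (swap_tm_raw_skel x y Q)"
| "swap_tm_raw_skel x y (RSApp Q R) = RSApp (swap_tm_raw_skel x y Q) (swap_tm_raw_skel x y R)"
| "swap_tm_raw_skel x y (RSAll a Q) = RSAll a (swap_tm_raw_skel x y Q)"
| "swap_tm_raw_skel x y (RSExp s A Q) = RSExp s A (swap_tm_raw_skel x y Q)"
| "swap_tm_raw_skel x y (RSCo Q T) = RSCo (swap_tm_raw_skel x y Q) T"

primrec swap_raw_skel :: "tyvar \<Rightarrow> tyvar \<Rightarrow> raw_skel \<Rightarrow> raw_skel" where
  "swap_raw_skel a b (RSVar x \<Gamma>) = RSVar x (fmmap (swap_ty a b) \<Gamma>)"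
| "swap_raw_skel a b (RSLam x Q) = RSLam x (swap_raw_skel a b Q)"
| "swap_raw_skel a b (RSApp Q R) = RSApp (swap_raw_skel a b Q) (swap_raw_skel a b R)"
| "swap_raw_skel a b (RSAll c Q) = RSAll (transpose a b c) (swap_raw_skel a b Q)"
| "swap_raw_skel a b (RSExp s A Q) = RSExp s (transpose a b |`| A) (swap_raw_skel a b Q)"
| "swap_raw_skel a b (RSCo Q T) = RSCo (swap_raw_skel a b Q) (swap_ty a b T)"

inductive skel_eq :: "raw_skel \<Rightarrow> raw_skel \<Rightarrow> bool" where
  refl: "skel_eq Q Q"
| sym: "skel_eq Q R \<Longrightarrow> skel_eq R Q"
| trans: "skel_eq Q R \<Longrightarrow> skel_eq R S \<Longrightarrow> skel_eq Q S"
| Lam: "skel_eq Q R \<Longrightarrow> skel_eq (RSLam x Q) (RSLam x R)"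
| App: "skel_eq Q Q' \<Longrightarrow> skel_eq R R' \<Longrightarrow> skel_eq (RSApp Q R) (RSApp Q' R')"
| All: "skel_eq Q R \<Longrightarrow> skel_eq (RSAll a Q) (RSAll a R)"
| Exp: "skel_eq Q R \<Longrightarrow> skel_eq (RSExp s A Q) (RSExp s A R)"
| Co: "skel_eq Q R \<Longrightarrow> skel_eq (RSCo Q T) (RSCo R T)"
| alpha_tm: "y |\<notin>| fv_raw_skel Q \<Longrightarrow> skel_eq (RSLam x Q) (RSLam y (swap_tm_raw_skel x y Q))"
| alpha_ty: "b |\<notin>| ftv_raw_skel Q \<Longrightarrow> skel_eq (RSAll a Q) (RSAll b (swap_raw_skel a b Q))"

quotient_type skel = raw_skel / skel_eq
  by (intro equivpI reflpI sympI transpI) (blast intro: skel_eq.intros)+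

lift_definition SVar :: "tmvar \<Rightarrow> env \<Rightarrow> skel" is RSVar .
lift_definition SLam :: "tmvar \<Rightarrow> skel \<Rightarrow> skel" is RSLam by (rule skel_eq.Lam)
lift_definition SApp :: "skel \<Rightarrow> skel \<Rightarrow> skel" is RSApp by (rule skel_eq.App)
lift_definition SAll :: "tyvar \<Rightarrow> skel \<Rightarrow> skel" is RSAll by (rule skel_eq.All)
lift_definition SExp :: "evar \<Rightarrow> tyvar fset \<Rightarrow> skel \<Rightarrow> skel" is RSExp by (rule skel_eq.Exp)
lift_definition SCo :: "skel \<Rightarrow> ty \<Rightarrow> skel" is RSCo by (rule skel_eq.Co)

lemma fmlookup_swap_dom [simp]: "fmlookup (swap_dom x y \<Gamma>) z = fmlookup \<Gamma> (transpose x y z)"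
proof -
  have "dom (fmlookup \<Gamma> \<circ> transpose x y) = transpose x y ` dom (fmlookup \<Gamma>)"
    by (rule set_eqI) (simp add: dom_def in_transpose_image_iff)
  then have "finite (dom (fmlookup \<Gamma> \<circ> transpose x y))" by simp
  then show ?thesis unfolding swap_dom_def by (subst Abs_fmap_inverse) simp_all
qed

lemma fmran_swap_dom [simp]: "fmran (swap_dom x y \<Gamma>) = fmran \<Gamma>"
  by (rule fset_eqI) (simp add: fmlookup_ran_iff, metis transpose_involutory)

lemma fmdom_swap_dom [simp]: "fmdom (swap_dom x y \<Gamma>) = transpose x y |`| fmdom \<Gamma>"
  by (rule fset_eqI) (simp add: fin_swap fmlookup_dom_iff)

lemma fUnions_swap: "transpose a b |`| fUnions f A = fUnions (\<lambda>x. transpose a b |`| f x) A"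
  by (rule fset_eqI) (simp add: fin_swap)

lemma fv_swap_tm_raw_skel: "fv_raw_skel (swap_tm_raw_skel x y Q) = transpose x y |`| fv_raw_skel Q"
  by (induct Q) (simp_all add: fimage_funion swap_fminus)

lemma fv_swap_raw_skel: "fv_raw_skel (swap_raw_skel a b Q) = fv_raw_skel Q"
  by (induct Q) simp_all

lemma ftv_swap_tm_raw_skel: "ftv_raw_skel (swap_tm_raw_skel x y Q) = ftv_raw_skel Q"
  by (induct Q) simp_all

lemma ftv_swap_raw_skel: "ftv_raw_skel (swap_raw_skel a b Q) = transpose a b |`| ftv_raw_skel Q"
  by (induct Q) (simp_all add: fimage_funion swap_fminus fimage_fimage o_def fUnions_swap ftv_swap_ty)

lemma evs_swap_tm_raw_skel: "evs_raw_skel (swap_tm_raw_skel x y Q) = evs_raw_skel Q"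
  by (induct Q) simp_all

lemma evs_swap_raw_skel: "evs_raw_skel (swap_raw_skel a b Q) = evs_raw_skel Q"
  by (induct Q) (simp_all add: fimage_fimage o_def)

lemma swap_tm_swap_raw_skel:
  "swap_tm_raw_skel x y (swap_raw_skel a b Q) = swap_raw_skel a b (swap_tm_raw_skel x y Q)"
  by (induct Q) (simp_all, rule fmap_ext, simp)

lemma swap_tm_swap_tm_raw_skel:
  "swap_tm_raw_skel x y (swap_tm_raw_skel z w Q) =
    swap_tm_raw_skel (transpose x y z) (transpose x y w) (swap_tm_raw_skel x y Q)"
  by (induct Q) (simp_all add: transpose_conj[of x y z w],
    rule fmap_ext, simp, metis transpose_conj transpose_involutory)

lemma swap_swap_raw_skel:
  "swap_raw_skel a b (swap_raw_skel c d Q) =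
    swap_raw_skel (transpose a b c) (transpose a b d) (swap_raw_skel a b Q)"
  by (induct Q) (simp_all add: transpose_conj[of a b c d] swap_swap_ty[of a b c d] o_def
    fmap.map_comp)

lemma fv_raw_skel_eq: "skel_eq Q R \<Longrightarrow> fv_raw_skel Q = fv_raw_skel R"
  by (induct rule: skel_eq.induct) (simp_all add: fv_swap_tm_raw_skel fv_swap_raw_skel fminus_swap)

lemma ftv_raw_skel_eq: "skel_eq Q R \<Longrightarrow> ftv_raw_skel Q = ftv_raw_skel R"
  by (induct rule: skel_eq.induct) (simp_all add: ftv_swap_tm_raw_skel ftv_swap_raw_skel fminus_swap)

lemma evs_raw_skel_eq: "skel_eq Q R \<Longrightarrow> evs_raw_skel Q = evs_raw_skel R"
  by (induct rule: skel_eq.induct) (simp_all add: evs_swap_tm_raw_skel evs_swap_raw_skel)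

lemma swap_tm_raw_skel_eq:
  "skel_eq Q R \<Longrightarrow> skel_eq (swap_tm_raw_skel x y Q) (swap_tm_raw_skel x y R)"
proof (induct rule: skel_eq.induct)
  case (alpha_tm w Q z)
  then show ?case
    using skel_eq.alpha_tm[of "transpose x y w" "swap_tm_raw_skel x y Q" "transpose x y z"]
    by (simp add: swap_tm_swap_tm_raw_skel[of x y z w] fv_swap_tm_raw_skel fin_swap)
next
  case (alpha_ty b Q a)
  then show ?case
    using skel_eq.alpha_ty[of b "swap_tm_raw_skel x y Q" a]
    by (simp add: swap_tm_swap_raw_skel ftv_swap_tm_raw_skel)
qed (auto intro: skel_eq.intros)

lemma swap_raw_skel_eq:
  "skel_eq Q R \<Longrightarrow> skel_eq (swap_raw_skel a b Q) (swap_raw_skel a b R)"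
proof (induct rule: skel_eq.induct)
  case (alpha_tm y Q x)
  then show ?case
    using skel_eq.alpha_tm[of y "swap_raw_skel a b Q" x]
    by (simp add: swap_tm_swap_raw_skel fv_swap_raw_skel)
next
  case (alpha_ty d Q c)
  then show ?case
    using skel_eq.alpha_ty[of "transpose a b d" "swap_raw_skel a b Q" "transpose a b c"]
    by (simp add: swap_swap_raw_skel[of a b c d] ftv_swap_raw_skel fin_swap)
qed (auto intro: skel_eq.intros)

lift_definition fv_skel :: "skel \<Rightarrow> tmvar fset" is fv_raw_skel by (rule fv_raw_skel_eq)
lift_definition ftv_skel :: "skel \<Rightarrow> tyvar fset" is ftv_raw_skel by (rule ftv_raw_skel_eq)
lift_definition evs_skel :: "skel \<Rightarrow> evar fset" is evs_raw_skel by (rule evs_raw_skel_eq)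
lift_definition swap_tm_skel :: "tmvar \<Rightarrow> tmvar \<Rightarrow> skel \<Rightarrow> skel" is swap_tm_raw_skel
  by (rule swap_tm_raw_skel_eq)
lift_definition swap_skel :: "tyvar \<Rightarrow> tyvar \<Rightarrow> skel \<Rightarrow> skel" is swap_raw_skel
  by (rule swap_raw_skel_eq)

definition var_skel :: "skel \<Rightarrow> (tyvar + evar) fset" where
  "var_skel Q = Inl |`| ftv_skel Q |\<union>| Inr |`| evs_skel Q"

lemma fv_skel_simps [simp]:
  "fv_skel (SVar x \<Gamma>) = finsert x (fmdom \<Gamma>)"
  "fv_skel (SLam x Q) = fv_skel Q |-| {|x|}"
  "fv_skel (SApp Q R) = fv_skel Q |\<union>| fv_skel R"
  "fv_skel (SAll a Q) = fv_skel Q"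
  "fv_skel (SExp s A Q) = fv_skel Q"
  "fv_skel (SCo Q T) = fv_skel Q"
  by (transfer, simp)+

lemma ftv_skel_simps [simp]:
  "ftv_skel (SVar x \<Gamma>) = ftv_env \<Gamma>"
  "ftv_skel (SLam x Q) = ftv_skel Q"
  "ftv_skel (SApp Q R) = ftv_skel Q |\<union>| ftv_skel R"
  "ftv_skel (SAll a Q) = ftv_skel Q |-| {|a|}"
  "ftv_skel (SExp s A Q) = ftv_skel Q |\<union>| A"
  "ftv_skel (SCo Q T) = ftv_skel Q |\<union>| ftv_ty T"
       apply (simp add: SVar.abs_eq ftv_skel.abs_eq)
      apply (induct Q rule: skel.abs_induct, simp add: SLam.abs_eq ftv_skel.abs_eq)
     apply (induct Q rule: skel.abs_induct, induct R rule: skel.abs_induct,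
      simp add: SApp.abs_eq ftv_skel.abs_eq)
    apply (induct Q rule: skel.abs_induct, simp add: SAll.abs_eq ftv_skel.abs_eq)
   apply (induct Q rule: skel.abs_induct, simp add: SExp.abs_eq ftv_skel.abs_eq)
  apply (induct Q rule: skel.abs_induct, simp add: SCo.abs_eq ftv_skel.abs_eq)
  done

lemma evs_skel_simps [simp]:
  "evs_skel (SVar x \<Gamma>) = evs_env \<Gamma>"
  "evs_skel (SLam x Q) = evs_skel Q"
  "evs_skel (SApp Q R) = evs_skel Q |\<union>| evs_skel R"
  "evs_skel (SAll a Q) = evs_skel Q"
  "evs_skel (SExp s A Q) = finsert s (evs_skel Q)"
  "evs_skel (SCo Q T) = evs_skel Q |\<union>| evs_ty T"
       apply (simp add: SVar.abs_eq evs_skel.abs_eq)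
      apply (induct Q rule: skel.abs_induct, simp add: SLam.abs_eq evs_skel.abs_eq)
     apply (induct Q rule: skel.abs_induct, induct R rule: skel.abs_induct,
      simp add: SApp.abs_eq evs_skel.abs_eq)
    apply (induct Q rule: skel.abs_induct, simp add: SAll.abs_eq evs_skel.abs_eq)
   apply (induct Q rule: skel.abs_induct, simp add: SExp.abs_eq evs_skel.abs_eq)
  apply (induct Q rule: skel.abs_induct, simp add: SCo.abs_eq evs_skel.abs_eq)
  done

lemma swap_tm_skel_simps [simp]:
  "swap_tm_skel x y (SVar z \<Gamma>) = SVar (transpose x y z) (swap_dom x y \<Gamma>)"
  "swap_tm_skel x y (SLam z Q) = SLam (transpose x y z) (swap_tm_skel x y Q)"
  "swap_tm_skel x y (SApp Q R) = SApp (swap_tm_skel x y Q) (swap_tm_skel x y R)"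
  "swap_tm_skel x y (SAll a Q) = SAll a (swap_tm_skel x y Q)"
  "swap_tm_skel x y (SExp s A Q) = SExp s A (swap_tm_skel x y Q)"
  "swap_tm_skel x y (SCo Q T) = SCo (swap_tm_skel x y Q) T"
       apply (simp add: SVar.abs_eq swap_tm_skel.abs_eq)
      apply (induct Q rule: skel.abs_induct, simp add: SLam.abs_eq swap_tm_skel.abs_eq)
     apply (induct Q rule: skel.abs_induct, induct R rule: skel.abs_induct,
      simp add: SApp.abs_eq swap_tm_skel.abs_eq)
    apply (induct Q rule: skel.abs_induct, simp add: SAll.abs_eq swap_tm_skel.abs_eq)
   apply (induct Q rule: skel.abs_induct, simp add: SExp.abs_eq swap_tm_skel.abs_eq)
  apply (induct Q rule: skel.abs_induct, simp add: SCo.abs_eq swap_tm_skel.abs_eq)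
  done

lemma swap_skel_simps [simp]:
  "swap_skel a b (SVar x \<Gamma>) = SVar x (fmmap (swap_ty a b) \<Gamma>)"
  "swap_skel a b (SLam x Q) = SLam x (swap_skel a b Q)"
  "swap_skel a b (SApp Q R) = SApp (swap_skel a b Q) (swap_skel a b R)"
  "swap_skel a b (SAll c Q) = SAll (transpose a b c) (swap_skel a b Q)"
  "swap_skel a b (SExp s A Q) = SExp s (transpose a b |`| A) (swap_skel a b Q)"
  "swap_skel a b (SCo Q T) = SCo (swap_skel a b Q) (swap_ty a b T)"
       apply (simp add: SVar.abs_eq swap_skel.abs_eq)
      apply (induct Q rule: skel.abs_induct, simp add: SLam.abs_eq swap_skel.abs_eq)
     apply (induct Q rule: skel.abs_induct, induct R rule: skel.abs_induct,
      simp add: SApp.abs_eq swap_skel.abs_eq)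
    apply (induct Q rule: skel.abs_induct, simp add: SAll.abs_eq swap_skel.abs_eq)
   apply (induct Q rule: skel.abs_induct, simp add: SExp.abs_eq swap_skel.abs_eq)
  apply (induct Q rule: skel.abs_induct, simp add: SCo.abs_eq swap_skel.abs_eq)
  done

lemma SLam_alpha: "y |\<notin>| fv_skel Q \<Longrightarrow> SLam x Q = SLam y (swap_tm_skel x y Q)"
  by transfer (rule skel_eq.alpha_tm)

lemma SAll_alpha: "b |\<notin>| ftv_skel Q \<Longrightarrow> SAll a Q = SAll b (swap_skel a b Q)"
  by transfer (rule skel_eq.alpha_ty)

primrec expand_skel :: "expn \<Rightarrow> tyvar fset \<Rightarrow> skel \<Rightarrow> skel" where
  "expand_skel Eps A X = X"
| "expand_skel (EAll a E) A X = (if a |\<notin>| A then SAll a (expand_skel E A X) else expand_skel E A X)"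
| "expand_skel (EExp s A' E) A X = SExp s (A |\<union>| A') (expand_skel E A X)"
| "expand_skel (ECo E T) A X = SCo (expand_skel E A X) T"

lemma ftv_expand_skel: "ftv_skel (expand_skel E A Q) |\<subseteq>| ftv_expn E |\<union>| A |\<union>| ftv_skel Q"
  by (induct E) auto

lemma fv_expand_skel [simp]: "fv_skel (expand_skel E A Q) = fv_skel Q"
  by (induct E) auto

lemma swap_tm_expand_skel:
  "swap_tm_skel x y (expand_skel E A Q) = expand_skel E A (swap_tm_skel x y Q)"
  by (induct E) auto

lemma swap_expand_skel:
  "a |\<notin>| ftv_expn E \<Longrightarrow> b |\<notin>| ftv_expn E \<Longrightarrow>
    swap_skel a b (expand_skel E A Q) = expand_skel E (transpose a b |`| A) (swap_skel a b Q)"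
  by (induct E) (auto simp: swap_ty_fresh fimage_funion swap_fset_fresh fin_swap)

primrec psubst_raw_skel :: "(evar \<Rightarrow> expn) \<Rightarrow> raw_skel \<Rightarrow> (tyvar \<Rightarrow> ty) \<Rightarrow> skel" where
  "psubst_raw_skel \<eta> (RSVar x \<Gamma>) \<theta> = SVar x (fmmap (\<lambda>T. psubst_ty \<eta> T \<theta>) \<Gamma>)"
| "psubst_raw_skel \<eta> (RSLam x Q) \<theta> = SLam x (psubst_raw_skel \<eta> Q \<theta>)"
| "psubst_raw_skel \<eta> (RSApp Q R) \<theta> = SApp (psubst_raw_skel \<eta> Q \<theta>) (psubst_raw_skel \<eta> R \<theta>)"
| "psubst_raw_skel \<eta> (RSAll a Q) \<theta> =
    (let b = fresh (image_ftv \<theta> \<eta> (ftv_raw_skel Q |-| {|a|}) (evs_raw_skel Q))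
     in SAll b (psubst_raw_skel \<eta> Q (\<theta>(a := TVar b))))"
| "psubst_raw_skel \<eta> (RSExp s A Q) \<theta> =
    expand_skel (\<eta> s) (fUnions (\<lambda>a. ftv_ty (\<theta> a)) A) (psubst_raw_skel \<eta> Q \<theta>)"
| "psubst_raw_skel \<eta> (RSCo Q T) \<theta> = SCo (psubst_raw_skel \<eta> Q \<theta>) (psubst_ty \<eta> T \<theta>)"

lemma psubst_raw_skel_cong:
  "(\<And>a. a |\<in>| ftv_raw_skel Q \<Longrightarrow> \<theta> a = \<theta>' a) \<Longrightarrow> psubst_raw_skel \<eta> Q \<theta> = psubst_raw_skel \<eta> Q \<theta>'"
proof (induct Q arbitrary: \<theta> \<theta>')
  case (RSVar x \<Gamma>)
  have "fmmap (\<lambda>T. psubst_ty \<eta> T \<theta>) \<Gamma> = fmmap (\<lambda>T. psubst_ty \<eta> T \<theta>') \<Gamma>"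
  proof (rule fmap.map_cong0)
    fix T assume "T \<in> fmran' \<Gamma>"
    then have "T |\<in>| fmran \<Gamma>" by (simp add: fmran'_alt_def)
    then show "psubst_ty \<eta> T \<theta> = psubst_ty \<eta> T \<theta>'"
      using RSVar by (intro psubst_ty_cong) auto
  qed
  then show ?case by simp
next
  case (RSLam x Q)
  have "psubst_raw_skel \<eta> Q \<theta> = psubst_raw_skel \<eta> Q \<theta>'"
    by (rule RSLam(1)) (simp add: RSLam(2))
  then show ?case by simp
next
  case (RSApp Q R)
  have "psubst_raw_skel \<eta> Q \<theta> = psubst_raw_skel \<eta> Q \<theta>'" "psubst_raw_skel \<eta> R \<theta> = psubst_raw_skel \<eta> R \<theta>'"
    by (rule RSApp(1) RSApp(2), simp add: RSApp(3))+
  then show ?case by simp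
next
  case (RSAll a Q)
  have "image_ftv \<theta> \<eta> (ftv_raw_skel Q |-| {|a|}) (evs_raw_skel Q) =
      image_ftv \<theta>' \<eta> (ftv_raw_skel Q |-| {|a|}) (evs_raw_skel Q)"
    by (rule image_ftv_cong) (simp add: RSAll(2))
  moreover have "psubst_raw_skel \<eta> Q (\<theta>(a := TVar b)) = psubst_raw_skel \<eta> Q (\<theta>'(a := TVar b))" for b
    by (rule RSAll(1)) (simp add: RSAll(2))
  ultimately show ?case by (simp add: Let_def)
next
  case (RSExp s A Q)
  have "fUnions (\<lambda>a. ftv_ty (\<theta> a)) A = fUnions (\<lambda>a. ftv_ty (\<theta>' a)) A"
    by (intro arg_cong[of _ _ ffUnion] fimage_cong) (simp_all add: RSExp(2))
  moreover have "psubst_raw_skel \<eta> Q \<theta> = psubst_raw_skel \<eta> Q \<theta>'"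
    by (rule RSExp(1)) (simp add: RSExp(2))
  ultimately show ?case by simp
next
  case (RSCo Q T)
  have "psubst_raw_skel \<eta> Q \<theta> = psubst_raw_skel \<eta> Q \<theta>'"
    by (rule RSCo(1)) (simp add: RSCo(2))
  moreover have "psubst_ty \<eta> T \<theta> = psubst_ty \<eta> T \<theta>'"
    by (rule psubst_ty_cong) (simp add: RSCo(2))
  ultimately show ?case by simp
qed

lemma ftv_psubst_raw_skel:
  "ftv_skel (psubst_raw_skel \<eta> Q \<theta>) |\<subseteq>| image_ftv \<theta> \<eta> (ftv_raw_skel Q) (evs_raw_skel Q)"
proof (induct Q arbitrary: \<theta>)
  case (RSVar x \<Gamma>)
  have "ftv_ty (psubst_ty \<eta> T \<theta>) |\<subseteq>| image_ftv \<theta> \<eta> (ftv_env \<Gamma>) (evs_env \<Gamma>)" if "T |\<in>| fmran \<Gamma>" for T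
    using ftv_psubst_ty[of \<eta> T \<theta>] that by (fastforce simp: in_image_ftv fsubset_iff)
  then have "x |\<in>| image_ftv \<theta> \<eta> (ftv_env \<Gamma>) (evs_env \<Gamma>)"
    if "T |\<in>| fmran \<Gamma>" "x |\<in>| ftv_ty (psubst_ty \<eta> T \<theta>)" for x T
    using that by blast
  then show ?case by (simp add: fsubset_iff) blast
next
  case (RSLam x Q)
  then show ?case by simp
next
  case (RSApp Q R)
  then show ?case by (fastforce simp: in_image_ftv fsubset_iff)
next
  case (RSAll a Q)
  define b where "b = fresh (image_ftv \<theta> \<eta> (ftv_raw_skel Q |-| {|a|}) (evs_raw_skel Q))"
  have "ftv_skel (psubst_raw_skel \<eta> Q (\<theta>(a := TVar b))) |\<subseteq>|
      image_ftv (\<theta>(a := TVar b)) \<eta> (ftv_raw_skel Q) (evs_raw_skel Q)"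
    by (rule RSAll)
  then show ?case
    by (auto simp: Let_def b_def[symmetric] in_image_ftv fsubset_iff split: if_splits)
next
  case (RSExp s A Q)
  have "ftv_skel (psubst_raw_skel \<eta> (RSExp s A Q) \<theta>) |\<subseteq>|
     ftv_expn (\<eta> s) |\<union>| fUnions (\<lambda>a. ftv_ty (\<theta> a)) A |\<union>| ftv_skel (psubst_raw_skel \<eta> Q \<theta>)"
    by (simp add: ftv_expand_skel)
  with RSExp[of \<theta>] show ?case
    by (fastforce simp: in_image_ftv fsubset_iff)
next
  case (RSCo Q T)
  with ftv_psubst_ty[of \<eta> T \<theta>] show ?case by (fastforce simp: in_image_ftv fsubset_iff)
qed

lemma fv_psubst_raw_skel: "fv_skel (psubst_raw_skel \<eta> Q \<theta>) = fv_raw_skel Q"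
  by (induct Q arbitrary: \<theta>) (simp_all add: Let_def)

lemma psubst_raw_skel_swap_tm:
  "psubst_raw_skel \<eta> (swap_tm_raw_skel x y Q) \<theta> = swap_tm_skel x y (psubst_raw_skel \<eta> Q \<theta>)"
  by (induct Q arbitrary: \<theta>)
    (simp_all add: Let_def ftv_swap_tm_raw_skel evs_swap_tm_raw_skel swap_tm_expand_skel,
     rule arg_cong[of _ _ "SVar _"], rule fmap_ext, simp)

lemma psubst_raw_skel_swap:
  "psubst_raw_skel \<eta> (swap_raw_skel a b Q) \<theta> = psubst_raw_skel \<eta> Q (\<theta> \<circ> transpose a b)"
proof (induct Q arbitrary: \<theta>)
  case (RSVar x \<Gamma>)
  have "fmmap (\<lambda>T. psubst_ty \<eta> T \<theta>) (fmmap (swap_ty a b) \<Gamma>) = fmmap (\<lambda>T. psubst_ty \<eta> T (\<theta> \<circ> transpose a b)) \<Gamma>"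
    by (rule fmap_ext) (simp add: option.map_comp o_def[of "\<lambda>T. psubst_ty \<eta> T \<theta>"] psubst_ty_swap)
  then show ?case by (simp only: swap_raw_skel.simps psubst_raw_skel.simps)
next
  case (RSAll c Q)
  have "image_ftv \<theta> \<eta> (ftv_raw_skel (swap_raw_skel a b Q) |-| {|transpose a b c|}) S =
        image_ftv (\<theta> \<circ> transpose a b) \<eta> (ftv_raw_skel Q |-| {|c|}) S" for S
    by (simp add: fset_eq_iff in_image_ftv ftv_swap_raw_skel fin_swap)
      (metis transpose_involutory)
  moreover have "\<theta>(transpose a b c := X) \<circ> transpose a b = (\<theta> \<circ> transpose a b)(c := X)" for X
    by (auto simp: fun_eq_iff transpose_eq_iff)
  ultimately show ?case
    by (simp only: swap_raw_skel.simps psubst_raw_skel.simps RSAll evs_swap_raw_skel Let_def)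
next
  case (RSExp s A Q)
  then show ?case by (simp add: fimage_fimage o_def)
qed (simp_all add: psubst_ty_swap o_def)

lemma psubst_raw_skel_rename:
  assumes swp: "\<And>c d \<theta>. c |\<notin>| fUnions (\<lambda>s. ftv_expn (\<eta> s)) (evs_raw_skel Q) \<Longrightarrow>
      d |\<notin>| fUnions (\<lambda>s. ftv_expn (\<eta> s)) (evs_raw_skel Q) \<Longrightarrow>
      swap_skel c d (psubst_raw_skel \<eta> Q \<theta>) = psubst_raw_skel \<eta> Q (swap_ty c d \<circ> \<theta>)"
    and b: "b |\<notin>| image_ftv \<theta> \<eta> (ftv_raw_skel Q |-| {|a|}) (evs_raw_skel Q)"
    and b': "b' |\<notin>| image_ftv \<theta> \<eta> (ftv_raw_skel Q |-| {|a|}) (evs_raw_skel Q)"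
  shows "SAll b (psubst_raw_skel \<eta> Q (\<theta>(a := TVar b))) = SAll b' (psubst_raw_skel \<eta> Q (\<theta>(a := TVar b')))"
proof (cases "b = b'")
  case False
  have "b' |\<notin>| ftv_skel (psubst_raw_skel \<eta> Q (\<theta>(a := TVar b)))"
  proof
    assume "b' |\<in>| ftv_skel (psubst_raw_skel \<eta> Q (\<theta>(a := TVar b)))"
    then have "b' |\<in>| image_ftv (\<theta>(a := TVar b)) \<eta> (ftv_raw_skel Q) (evs_raw_skel Q)"
      using ftv_psubst_raw_skel by blast
    with b' False show False by (auto simp: in_image_ftv split: if_splits)
  qed
  then have "SAll b (psubst_raw_skel \<eta> Q (\<theta>(a := TVar b))) =
      SAll b' (swap_skel b b' (psubst_raw_skel \<eta> Q (\<theta>(a := TVar b))))"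
    by (rule SAll_alpha)
  also have "swap_skel b b' (psubst_raw_skel \<eta> Q (\<theta>(a := TVar b))) =
      psubst_raw_skel \<eta> Q (swap_ty b b' \<circ> \<theta>(a := TVar b))"
    using b b' by (intro swp) (auto simp: in_image_ftv)
  also have "\<dots> = psubst_raw_skel \<eta> Q (\<theta>(a := TVar b'))"
  proof (rule psubst_raw_skel_cong)
    fix c assume "c |\<in>| ftv_raw_skel Q"
    then show "(swap_ty b b' \<circ> \<theta>(a := TVar b)) c = (\<theta>(a := TVar b')) c"
      using b b' by (auto simp: in_image_ftv intro!: swap_ty_fresh)
  qed
  finally show ?thesis .
qed simp

lemma psubst_raw_skel_swap_image:
  assumes "c |\<notin>| fUnions (\<lambda>s. ftv_expn (\<eta> s)) (evs_raw_skel Q)"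
    and "d |\<notin>| fUnions (\<lambda>s. ftv_expn (\<eta> s)) (evs_raw_skel Q)"
  shows "swap_skel c d (psubst_raw_skel \<eta> Q \<theta>) = psubst_raw_skel \<eta> Q (swap_ty c d \<circ> \<theta>)"
  using assms
proof (induct Q arbitrary: c d \<theta>)
  case (RSVar x \<Gamma>)
  have "fmmap (\<lambda>T. swap_ty c d (psubst_ty \<eta> T \<theta>)) \<Gamma> = fmmap (\<lambda>T. psubst_ty \<eta> T (swap_ty c d \<circ> \<theta>)) \<Gamma>"
  proof (rule fmap.map_cong0)
    fix T assume "T \<in> fmran' \<Gamma>"
    then have "T |\<in>| fmran \<Gamma>" by (simp add: fmran'_alt_def)
    then show "swap_ty c d (psubst_ty \<eta> T \<theta>) = psubst_ty \<eta> T (swap_ty c d \<circ> \<theta>)"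
      using RSVar by (intro psubst_ty_swap_image) (simp_all, blast+)
  qed
  then show ?case by (simp add: fmap.map_comp o_def)
next
  case (RSLam x Q)
  then show ?case by (simp add: o_def)
next
  case (RSApp Q R)
  have "swap_skel c d (psubst_raw_skel \<eta> Q \<theta>) = psubst_raw_skel \<eta> Q (swap_ty c d \<circ> \<theta>)"
    using RSApp(3,4) by (intro RSApp(1)) auto
  moreover have "swap_skel c d (psubst_raw_skel \<eta> R \<theta>) = psubst_raw_skel \<eta> R (swap_ty c d \<circ> \<theta>)"
    using RSApp(3,4) by (intro RSApp(2)) auto
  ultimately show ?case by (simp add: o_def)
next
  case (RSAll a Q)
  define F where "F = image_ftv \<theta> \<eta> (ftv_raw_skel Q |-| {|a|}) (evs_raw_skel Q)"
  define G where "G = image_ftv (swap_ty c d \<circ> \<theta>) \<eta> (ftv_raw_skel Q |-| {|a|}) (evs_raw_skel Q)"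
  define b where "b = fresh F"
  have "transpose c d b |\<notin>| G"
    unfolding G_def b_def using RSAll(2,3) fresh[of F]
    by (intro image_ftv_swap) (auto simp: F_def)
  then have "SAll (transpose c d b) (psubst_raw_skel \<eta> Q ((swap_ty c d \<circ> \<theta>)(a := TVar (transpose c d b))))
      = SAll (fresh G) (psubst_raw_skel \<eta> Q ((swap_ty c d \<circ> \<theta>)(a := TVar (fresh G))))"
    using fresh[of G] unfolding G_def by (intro psubst_raw_skel_rename RSAll(1))
  moreover have "swap_skel c d (psubst_raw_skel \<eta> Q (\<theta>(a := TVar b))) =
      psubst_raw_skel \<eta> Q (swap_ty c d \<circ> \<theta>(a := TVar b))"
    using RSAll(2,3) by (intro RSAll(1)) simp_all
  moreover have "swap_ty c d \<circ> \<theta>(a := TVar b) = (swap_ty c d \<circ> \<theta>)(a := TVar (transpose c d b))"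
    by (auto simp: fun_eq_iff)
  ultimately show ?case
    by (simp only: psubst_raw_skel.simps Let_def swap_skel_simps F_def[symmetric] G_def[symmetric]
        b_def[symmetric])
next
  case (RSExp s A Q)
  have "transpose c d |`| fUnions (\<lambda>a. ftv_ty (\<theta> a)) A = fUnions (\<lambda>a. ftv_ty ((swap_ty c d \<circ> \<theta>) a)) A"
    by (rule fset_eqI) (simp only: fin_transpose_image fUnions_iff o_def ftv_swap_ty)
  moreover have "swap_skel c d (psubst_raw_skel \<eta> Q \<theta>) = psubst_raw_skel \<eta> Q (swap_ty c d \<circ> \<theta>)"
    using RSExp(2,3) by (intro RSExp(1)) (simp_all add: fUnions_iff)
  ultimately show ?case using RSExp(2,3) by (simp add: swap_expand_skel o_def)
next
  case (RSCo Q T)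
  have "swap_skel c d (psubst_raw_skel \<eta> Q \<theta>) = psubst_raw_skel \<eta> Q (swap_ty c d \<circ> \<theta>)"
    using RSCo(2,3) by (intro RSCo(1)) auto
  moreover have "swap_ty c d (psubst_ty \<eta> T \<theta>) = psubst_ty \<eta> T (swap_ty c d \<circ> \<theta>)"
    using RSCo(2,3) by (intro psubst_ty_swap_image) auto
  ultimately show ?case by (simp add: o_def)
qed

lemma psubst_raw_skel_All:
  assumes "b |\<notin>| image_ftv \<theta> \<eta> (ftv_raw_skel Q |-| {|a|}) (evs_raw_skel Q)"
  shows "psubst_raw_skel \<eta> (RSAll a Q) \<theta> = SAll b (psubst_raw_skel \<eta> Q (\<theta>(a := TVar b)))"
  unfolding psubst_raw_skel.simps Let_def
  by (intro psubst_raw_skel_rename psubst_raw_skel_swap_image fresh assms)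

lemma psubst_raw_skel_eq: "skel_eq Q R \<Longrightarrow> psubst_raw_skel \<eta> Q \<theta> = psubst_raw_skel \<eta> R \<theta>"
proof (induct arbitrary: \<theta> rule: skel_eq.induct)
  case (All Q R a)
  show ?case
    by (simp only: psubst_raw_skel.simps ftv_raw_skel_eq[OF All(1)] evs_raw_skel_eq[OF All(1)] All(2))
next
  case (alpha_tm y Q x)
  then show ?case by (simp add: psubst_raw_skel_swap_tm fv_psubst_raw_skel SLam_alpha[of y])
next
  case (alpha_ty b Q a)
  define c where "c = fresh (image_ftv \<theta> \<eta> (ftv_raw_skel Q |-| {|a|}) (evs_raw_skel Q))"
  have "psubst_raw_skel \<eta> (swap_raw_skel a b Q) (\<theta>(b := TVar c)) = psubst_raw_skel \<eta> Q (\<theta>(a := TVar c))"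
    unfolding psubst_raw_skel_swap
  proof (rule psubst_raw_skel_cong)
    fix x assume "x |\<in>| ftv_raw_skel Q"
    with alpha_ty show "(\<theta>(b := TVar c) \<circ> transpose a b) x = (\<theta>(a := TVar c)) x"
      by (cases "x = a"; cases "x = b") auto
  qed
  then show ?case
    by (simp add: Let_def ftv_swap_raw_skel evs_swap_raw_skel fminus_swap[OF alpha_ty] c_def)
qed simp_all

definition subst_skel :: "subst \<Rightarrow> skel \<Rightarrow> skel" where
  "subst_skel \<sigma> Q = psubst_raw_skel (subst_evar \<sigma>) (rep_skel Q) (subst_tyvar \<sigma>)"

lemma subst_skel_abs:
  "subst_skel \<sigma> (abs_skel R) = psubst_raw_skel (subst_evar \<sigma>) R (subst_tyvar \<sigma>)"
  unfolding subst_skel_def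
  by (rule psubst_raw_skel_eq) (metis Quotient3_abs_rep Quotient3_skel skel.abs_eq_iff)

lemma subst_skel_simps:
  "subst_skel \<sigma> (SVar x \<Gamma>) = SVar x (subst_env \<sigma> \<Gamma>)"
  "subst_skel \<sigma> (SLam x Q) = SLam x (subst_skel \<sigma> Q)"
  "subst_skel \<sigma> (SApp Q R) = SApp (subst_skel \<sigma> Q) (subst_skel \<sigma> R)"
  "a |\<notin>| ftv_subst \<sigma> \<Longrightarrow> subst_skel \<sigma> (SAll a Q) = SAll a (subst_skel \<sigma> Q)"
  "subst_skel \<sigma> (SExp s A Q) =
    expand_skel (subst_evar \<sigma> s) (ftv_subst_image \<sigma> A) (subst_skel \<sigma> Q)"
  "subst_skel \<sigma> (SCo Q T) = SCo (subst_skel \<sigma> Q) (subst_ty \<sigma> T)"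
       apply (simp add: SVar.abs_eq subst_skel_abs subst_ty_def[abs_def])
      apply (induct Q rule: skel.abs_induct, simp add: SLam.abs_eq subst_skel_abs)
     apply (induct Q rule: skel.abs_induct, induct R rule: skel.abs_induct,
      simp add: SApp.abs_eq subst_skel_abs)
    apply (induct Q rule: skel.abs_induct,
      simp only: SAll.abs_eq subst_skel_abs psubst_raw_skel_All[OF image_ftv_subst_fresh]
        subst_tyvar_upd simp_thms)
   apply (induct Q rule: skel.abs_induct, simp add: SExp.abs_eq subst_skel_abs)
  apply (induct Q rule: skel.abs_induct, simp add: SCo.abs_eq subst_skel_abs subst_ty_def)
  done


section \<open>Typing\<close>

inductive typing :: "skel \<Rightarrow> tm \<Rightarrow> env \<Rightarrow> ty \<Rightarrow> constr \<Rightarrow> bool"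
    ("(_ \<triangleright>/ _ :/ \<langle>_ \<turnstile> _\<rangle>'/_)" [51, 51, 51, 51, 51] 50) where
  Var: "fmlookup \<Gamma> x = Some T \<Longrightarrow> SVar x \<Gamma> \<triangleright> Var x : \<langle>\<Gamma> \<turnstile> T\<rangle>/Omega"
| Lam: "x |\<notin>| fmdom \<Gamma> \<Longrightarrow> Q \<triangleright> t : \<langle>fmupd x T1 \<Gamma> \<turnstile> T2\<rangle>/C \<Longrightarrow>
    SLam x Q \<triangleright> Lam x t : \<langle>\<Gamma> \<turnstile> TArr T1 T2\<rangle>/C"
| App: "Q1 \<triangleright> t1 : \<langle>\<Gamma> \<turnstile> TArr T1 T2\<rangle>/C1 \<Longrightarrow> Q2 \<triangleright> t2 : \<langle>\<Gamma> \<turnstile> T1\<rangle>/C2 \<Longrightarrow>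
    SApp Q1 Q2 \<triangleright> App t1 t2 : \<langle>\<Gamma> \<turnstile> T2\<rangle>/(C1 \<^bold>\<and> C2)"
| All: "Q \<triangleright> t : \<langle>\<Gamma> \<turnstile> T\<rangle>/C \<Longrightarrow> a |\<notin>| ftv_env \<Gamma> \<Longrightarrow>
    SAll a Q \<triangleright> t : \<langle>\<Gamma> \<turnstile> TAll a T\<rangle>/(CEx a C)"
| Exp: "Q \<triangleright> t : \<langle>\<Gamma> \<turnstile> T\<rangle>/C \<Longrightarrow> ftv_env \<Gamma> |\<subseteq>| A \<Longrightarrow>
    SExp s A Q \<triangleright> t : \<langle>\<Gamma> \<turnstile> TExp s A T\<rangle>/(CExp s A T C)"
| Co: "Q \<triangleright> t : \<langle>\<Gamma> \<turnstile> T1\<rangle>/C \<Longrightarrow> SCo Q T2 \<triangleright> t : \<langle>\<Gamma> \<turnstile> T2\<rangle>/(C \<^bold>\<and> T1 \<lessdot> T2)"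

definition tenv :: "skel \<Rightarrow> env" where
  "tenv Q = (THE \<Gamma>. \<exists>t T C. Q \<triangleright> t : \<langle>\<Gamma> \<turnstile> T\<rangle>/C)"

definition rtype :: "skel \<Rightarrow> ty" where
  "rtype Q = (THE T. \<exists>t \<Gamma> C. Q \<triangleright> t : \<langle>\<Gamma> \<turnstile> T\<rangle>/C)"

text \<open>
  The new skeleton form \<open>Weaken Q \<Gamma>\<close>, for \<open>Q\<close> weakened by \<open>\<Gamma>\<close>, is kept apart from
  \<open>skel\<close>: it records one final use of the weakening rule on a skeleton without weakening.
\<close>

datatype weak_skel = Weaken skel env

inductive weak_typing :: "weak_skel \<Rightarrow> tm \<Rightarrow> env \<Rightarrow> ty \<Rightarrow> constr \<Rightarrow> bool"
    ("(_ \<triangleright>\<^sub>w/ _ :/ \<langle>_ \<turnstile> _\<rangle>'/_)" [51, 51, 51, 51, 51] 50) where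
  "Q \<triangleright> t : \<langle>\<Gamma>1 \<turnstile> T\<rangle>/C \<Longrightarrow> fmdom \<Gamma>1 |\<inter>| fmdom \<Gamma>2 = {||} \<Longrightarrow>
    Weaken Q \<Gamma>2 \<triangleright>\<^sub>w t : \<langle>\<Gamma>1 ++\<^sub>f \<Gamma>2 \<turnstile> T\<rangle>/C"


section \<open>Initial skeletons\<close>

definition variable_env :: "env \<Rightarrow> bool" where
  "variable_env \<Xi> \<longleftrightarrow> (\<exists>f. inj_on f (fset (fmdom \<Xi>)) \<and>
    (\<forall>x. x |\<in>| fmdom \<Xi> \<longrightarrow> fmlookup \<Xi> x = Some (TVar (f x))))"

inductive init :: "env \<Rightarrow> tm \<Rightarrow> skel \<Rightarrow> bool" where
  Var: "variable_env \<Xi> \<Longrightarrow> x |\<in>| fmdom \<Xi> \<Longrightarrow> init \<Xi> (Var x) (SExp s (ftv_env \<Xi>) (SVar x \<Xi>))"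
| Lam: "variable_env \<Xi> \<Longrightarrow> x |\<notin>| fmdom \<Xi> \<Longrightarrow> variable_env (fmupd x (TVar a) \<Xi>) \<Longrightarrow>
    init (fmupd x (TVar a) \<Xi>) t Q \<Longrightarrow>
    Inr s |\<notin>| var_skel Q \<Longrightarrow> A = ftv_env (tenv (SLam x Q)) \<Longrightarrow>
    init \<Xi> (Lam x t) (SExp s A (SLam x Q))"
| App: "variable_env \<Xi> \<Longrightarrow> init \<Xi> t1 Q1 \<Longrightarrow> init \<Xi> t2 Q2 \<Longrightarrow>
    Q = SApp (SCo Q1 (TArr (rtype Q2) (TVar a))) Q2 \<Longrightarrow> A = ftv_env (tenv Q) \<Longrightarrow>
    (var_skel Q1 |\<inter>| var_skel Q2) |-| Inl |`| ftv_env \<Xi> = {||} \<Longrightarrow>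
    {|Inl a, Inr s|} |\<inter>| (var_skel Q1 |\<union>| var_skel Q2) = {||} \<Longrightarrow>
    init \<Xi> (App t1 t2) (SExp s A Q)"

definition initial_skel :: "skel \<Rightarrow> tm \<Rightarrow> bool" where
  "initial_skel Q t \<longleftrightarrow> (\<exists>\<Xi>. variable_env \<Xi> \<and> fmdom \<Xi> = fv t \<and> init \<Xi> t Q)"

end

theory Submission
  imports Defs
begin

text \<open>
  After restriction to the free variables of \<open>t\<close>, every judgement on \<open>t\<close> arises from a judgement
  whose last rule is syntax-directed by a sequence of rules for quantifiers, E-variables and
  subtyping, that is, by an expansion.  An initial skeleton has a distinct E-variable at each
  subterm, and a distinct type variable at each abstraction and at each application.  The
  substitution sends an E-variable to the expansion found at its subterm, the variable of an
  abstraction to the type of its parameter, and the variable of an application to its result type;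
  the coercion inserted at the application then becomes an instance of \<open>T \<lessdot> T\<close>.
\<close>

section \<open>Terms up to \<open>\<alpha>\<close>-conversion\<close>

lemma swap_swap_raw_tm:
  "swap_raw_tm x y (swap_raw_tm z w t) =
    swap_raw_tm (transpose x y z) (transpose x y w) (swap_raw_tm x y t)"
  by (induct t) (auto simp: transpose_conj[of x y z w])

lemma swap_raw_tm_eq: "tm_eq t u \<Longrightarrow> tm_eq (swap_raw_tm x y t) (swap_raw_tm x y u)"
proof (induct rule: tm_eq.induct)
  case (alpha w t z)
  then show ?case
    using tm_eq.alpha[of "transpose x y w" "swap_raw_tm x y t" "transpose x y z"]
    by (simp add: swap_swap_raw_tm[of x y z w] fv_swap_raw_tm fin_swap)
qed (auto intro: tm_eq.intros)

lift_definition swap_tm :: "tmvar \<Rightarrow> tmvar \<Rightarrow> tm \<Rightarrow> tm" is swap_raw_tm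
  by (rule swap_raw_tm_eq)

lemma swap_tm_simps [simp]:
  "swap_tm x y (Var z) = Var (transpose x y z)"
  "swap_tm x y (Lam z t) = Lam (transpose x y z) (swap_tm x y t)"
  "swap_tm x y (App t u) = App (swap_tm x y t) (swap_tm x y u)"
  by (transfer, simp add: tm_eq.refl)+

lemma tm_induct [case_names Var Lam App]:
  assumes "\<And>x. P (Var x)" "\<And>x t. P t \<Longrightarrow> P (Lam x t)" "\<And>t u. P t \<Longrightarrow> P u \<Longrightarrow> P (App t u)"
  shows "P t"
proof -
  have "P (abs_tm r)" for r
    by (induct r) (auto simp: assms simp flip: Var.abs_eq Lam.abs_eq App.abs_eq)
  then show ?thesis by (metis tm.abs_induct)
qed

lemma Lam_alpha: "y |\<notin>| fv t \<Longrightarrow> Lam x t = Lam y (swap_tm x y t)"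
  by transfer (rule tm_eq.alpha)

lemma swap_tm_commute: "swap_tm x y t = swap_tm y x t"
  by (induct t rule: tm_induct) (auto simp: transpose_commute)

lemma swap_tm_same [simp]: "swap_tm x x t = t"
  by (induct t rule: tm_induct) auto

lemma swap_tm_involutory [simp]: "swap_tm x y (swap_tm x y t) = t"
  by (induct t rule: tm_induct) auto

lemma swap_swap_tm:
  "swap_tm x y (swap_tm z w t) = swap_tm (transpose x y z) (transpose x y w) (swap_tm x y t)"
  by transfer (subst swap_swap_raw_tm, rule tm_eq.refl)

text \<open>If the bound name is \<open>x\<close> or \<open>y\<close>, the swap is itself an
  \<alpha>-conversion to the other name; otherwise both names are fresh for the body as
  well.\<close>

lemma swap_tm_fresh: "x |\<notin>| fv t \<Longrightarrow> y |\<notin>| fv t \<Longrightarrow> swap_tm x y t = t"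
proof (induct t rule: tm_induct)
  case (Lam z t)
  show ?case
  proof (cases "z = x \<or> z = y")
    case True
    define w where "w = (if z = x then y else x)"
    have sw: "swap_tm x y t = swap_tm z w t" "transpose x y z = w"
      using True by (auto simp: w_def swap_tm_commute)
    have "w |\<notin>| fv t \<or> w = z" using True Lam.prems by (auto simp: w_def fv_simps)
    then have "Lam z t = Lam w (swap_tm z w t)"
      using Lam_alpha[of w t z] by auto
    then show ?thesis unfolding swap_tm_simps sw by simp
  next
    case False
    with Lam have "swap_tm x y t = t" by (auto simp: fv_simps)
    with False show ?thesis by simp
  qed
qed (auto simp: fv_simps)

text \<open>Abstractions are compared at all but finitely many fresh names, which makes transitivity
  immediate.\<close>

fun same_head :: "raw_tm \<Rightarrow> raw_tm \<Rightarrow> bool" where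
  "same_head (RVar x) (RVar y) \<longleftrightarrow> x = y"
| "same_head (RLam x t) (RLam y u) \<longleftrightarrow>
    (\<exists>F. \<forall>z. z |\<notin>| F \<longrightarrow> swap_tm x z (abs_tm t) = swap_tm y z (abs_tm u))"
| "same_head (RApp t u) (RApp t' u') \<longleftrightarrow> abs_tm t = abs_tm t' \<and> abs_tm u = abs_tm u'"
| "same_head _ _ \<longleftrightarrow> False"

lemma same_head_trans: "same_head t u \<Longrightarrow> same_head u v \<Longrightarrow> same_head t v"
proof (induct t u rule: same_head.induct)
  case (2 x t y u)
  then obtain z w F G where "v = RLam z w"
    "\<forall>c. c |\<notin>| F \<longrightarrow> swap_tm x c (abs_tm t) = swap_tm y c (abs_tm u)"
    "\<forall>c. c |\<notin>| G \<longrightarrow> swap_tm y c (abs_tm u) = swap_tm z c (abs_tm w)"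
    by (cases v) auto
  then show ?case by (auto intro!: exI[of _ "F |\<union>| G"])
qed (cases v; auto)+

text \<open>For distinct \<open>x\<close> and \<open>y\<close>, conjugation turns the left side into
  \<open>swap_tm x z (swap_tm y z t)\<close>, whose inner swap exchanges two fresh names.\<close>

lemma swap_tm_via_fresh:
  assumes "y |\<notin>| fv t" "z |\<notin>| fv t" "z \<noteq> x"
  shows "swap_tm y z (swap_tm x y t) = swap_tm x z t"
proof (cases "x = y")
  case False
  then show ?thesis
    using assms by (simp add: swap_swap_tm[of y z x y] swap_tm_fresh)
qed simp

text \<open>Since \<open>same_head\<close> compares immediate subterms in the quotient, the
  congruence rules are immediate and renaming reduces to \<open>swap_tm_via_fresh\<close>.
  Distinctness and injectivity of the constructors are read off from this invariant.\<close>

lemma tm_eq_same_head: "tm_eq t u \<Longrightarrow> same_head t u"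
proof (induct rule: tm_eq.induct)
  case (refl t)
  then show ?case by (cases t) auto
next
  case (sym t u)
  then show ?case by (induct t u rule: same_head.induct) (auto, metis)
next
  case (trans t u v)
  then show ?case using same_head_trans by blast
next
  case (alpha y t x)
  have "swap_tm x z (abs_tm t) = swap_tm y z (abs_tm (swap_raw_tm x y t))"
    if "z |\<notin>| finsert x (fv (abs_tm t))" for z
    using that alpha
    by (simp add: swap_tm_via_fresh fv.abs_eq flip: swap_tm.abs_eq)
  then show ?case by auto
qed (auto simp flip: tm.abs_eq_iff)

lemma tm_distinct [simp]:
  "Var x \<noteq> Lam y t" "Lam y t \<noteq> Var x" "Var x \<noteq> App u v" "App u v \<noteq> Var x"
  "Lam y t \<noteq> App u v" "App u v \<noteq> Lam y t"
  by (transfer, auto dest: tm_eq_same_head)+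

lemma Var_inject [simp]: "Var x = Var y \<longleftrightarrow> x = y"
  by transfer (auto dest: tm_eq_same_head intro: tm_eq.refl)

lemma App_inject [simp]: "App t u = App t' u' \<longleftrightarrow> t = t' \<and> u = u'"
  by transfer (auto dest: tm_eq_same_head simp: tm.abs_eq_iff intro: tm_eq.App)

lemma Lam_eqD:
  assumes "Lam x t = Lam y u"
  shows "\<exists>F. \<forall>z. z |\<notin>| F \<longrightarrow> swap_tm x z t = swap_tm y z u"
  using assms
proof (induct t rule: tm.abs_induct, induct u rule: tm.abs_induct)
  case (1 u t)
  then have "tm_eq (RLam x t) (RLam y u)" by (simp add: Lam.abs_eq tm.abs_eq_iff)
  from tm_eq_same_head[OF this] show ?case by simp
qed

lemma fresh_tmvar: "\<exists>x :: tmvar. x |\<notin>| F"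
proof -
  have "inj TmVar" by (simp add: inj_def)
  then have "infinite (UNIV :: tmvar set)"
    by (metis finite_imageD finite_subset infinite_UNIV_nat subset_UNIV)
  then show ?thesis by (metis ex_new_if_finite finite_fset)
qed


section \<open>Environments and constraints\<close>

lemma in_ftv_env: "c |\<in>| ftv_env \<Gamma> \<longleftrightarrow> (\<exists>x T. fmlookup \<Gamma> x = Some T \<and> c |\<in>| ftv_ty T)"
  by (auto simp: fmlookup_ran_iff)

lemma ftv_env_fmupd: "x |\<notin>| fmdom \<Gamma> \<Longrightarrow> ftv_env (fmupd x T \<Gamma>) = ftv_ty T |\<union>| ftv_env \<Gamma>"
  unfolding fset_eq_iff funion_iff in_ftv_env
  by (auto simp: fmdom_notD split: if_splits) (metis fmdom_notD option.distinct(1))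

lemma ftv_env_mono:
  "(\<And>x T. fmlookup \<Gamma> x = Some T \<Longrightarrow> fmlookup \<Delta> x = Some T) \<Longrightarrow> ftv_env \<Gamma> |\<subseteq>| ftv_env \<Delta>"
  unfolding fsubset_iff in_ftv_env by blast

lemma swap_dom_fmupd:
  "swap_dom x y (fmupd z T \<Gamma>) = fmupd (transpose x y z) T (swap_dom x y \<Gamma>)"
  by (rule fmap_ext) (auto simp: transpose_eq_iff)

lemma swap_dom_fresh: "x |\<notin>| fmdom \<Gamma> \<Longrightarrow> y |\<notin>| fmdom \<Gamma> \<Longrightarrow> swap_dom x y \<Gamma> = \<Gamma>"
  by (rule fmap_ext) (simp, metis fmdom_notD transpose_eq_iff transpose_apply_other)

lemma Conj_assoc: "((C \<^bold>\<and> D) \<^bold>\<and> E) = (C \<^bold>\<and> (D \<^bold>\<and> E))"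
  by transfer (rule constr_eq.assoc)

lemma Conj_commute: "(C \<^bold>\<and> D) = (D \<^bold>\<and> C)"
  by transfer (rule constr_eq.comm)

lemma Conj_left_commute: "(C \<^bold>\<and> (D \<^bold>\<and> E)) = (D \<^bold>\<and> (C \<^bold>\<and> E))"
  by (metis Conj_assoc Conj_commute)

lemma Conj_Omega: "(C \<^bold>\<and> Omega) = C"
  by transfer (rule constr_eq.unit)

lemma CEx_Conj: "CEx a (C \<^bold>\<and> D) = (CEx a C \<^bold>\<and> CEx a D)"
  by transfer (rule constr_eq.Ex_Conj)

lemma CExp_Conj: "CExp s A T (C \<^bold>\<and> D) = (CExp s A T C \<^bold>\<and> CExp s A T D)"
  by transfer (rule constr_eq.CExp_Conj)

lemmas Conj_ac = Conj_assoc Conj_commute Conj_left_commute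


section \<open>Skeletons determine environments and types\<close>

text \<open>Serves to recover the type of an application from that of its function part. Because a
  vacuous quantifier may be dropped, the codomain has to be taken under quantifiers. The identity
  elsewhere is a default that adds no free variables and commutes with swaps.\<close>

primrec cod_raw_ty :: "raw_ty \<Rightarrow> raw_ty" where
  "cod_raw_ty (RTVar a) = RTVar a"
| "cod_raw_ty (RTArr T U) = U"
| "cod_raw_ty (RTAll a T) = RTAll a (cod_raw_ty T)"
| "cod_raw_ty (RTExp s A T) = RTExp s A T"

lemma ftv_cod_raw_ty: "ftv_raw_ty (cod_raw_ty T) |\<subseteq>| ftv_raw_ty T"
  by (induct T) auto

lemma cod_swap_raw_ty: "cod_raw_ty (swap_raw_ty a b T) = swap_raw_ty a b (cod_raw_ty T)"
  by (induct T) auto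

lemma cod_raw_ty_eq: "ty_eq T U \<Longrightarrow> ty_eq (cod_raw_ty T) (cod_raw_ty U)"
proof (induct rule: ty_eq.induct)
  case (alpha b T a)
  then show ?case
    using ftv_cod_raw_ty[of T] by (auto simp: cod_swap_raw_ty intro: ty_eq.alpha)
next
  case (vacuous a T)
  then show ?case
    using ftv_cod_raw_ty[of T] by (auto intro: ty_eq.vacuous)
qed (auto intro: ty_eq.intros)

lift_definition cod_ty :: "ty \<Rightarrow> ty" is cod_raw_ty by (rule cod_raw_ty_eq)

lemma cod_ty_TArr [simp]: "cod_ty (TArr T U) = U"
  by transfer (simp add: ty_eq.refl)

lemma ftv_cod_ty: "ftv_ty (cod_ty T) |\<subseteq>| ftv_ty T"
  by transfer (rule ftv_cod_raw_ty)

lemma cod_swap_ty: "cod_ty (swap_ty a b T) = swap_ty a b (cod_ty T)"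
  by transfer (simp add: cod_swap_raw_ty ty_eq.refl)

text \<open>The default is a closed type, so that lookup commutes with swapping type variables.\<close>

definition env_type :: "env \<Rightarrow> tmvar \<Rightarrow> ty" where
  "env_type \<Gamma> x = (case fmlookup \<Gamma> x of None \<Rightarrow> TAll (TyVar 0) (TVar (TyVar 0)) | Some T \<Rightarrow> T)"

lemma env_type_swap: "env_type (fmmap (swap_ty a b) \<Gamma>) x = swap_ty a b (env_type \<Gamma> x)"
  by (auto simp: env_type_def swap_ty_fresh[of a "TAll (TyVar 0) (TVar (TyVar 0))"]
      simp del: swap_ty_simps split: option.splits)

lemma ftv_env_type: "ftv_ty (env_type \<Gamma> x) |\<subseteq>| ftv_env \<Gamma>"
  unfolding fsubset_iff in_ftv_env env_type_def by (cases "fmlookup \<Gamma> x") auto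

text \<open>Quantifying the types of the environment is vacuous on valid skeletons, and makes the
  function invariant under renaming of the bound variable on the others.\<close>

primrec raw_skel_env :: "raw_skel \<Rightarrow> env" where
  "raw_skel_env (RSVar x \<Gamma>) = \<Gamma>"
| "raw_skel_env (RSLam x Q) = fmdrop x (raw_skel_env Q)"
| "raw_skel_env (RSApp Q R) = raw_skel_env Q"
| "raw_skel_env (RSAll a Q) = fmmap (TAll a) (raw_skel_env Q)"
| "raw_skel_env (RSExp s A Q) = raw_skel_env Q"
| "raw_skel_env (RSCo Q T) = raw_skel_env Q"

text \<open>An abstraction in a skeleton carries no annotation, so the type of its parameter is
  looked up in the environment of its body.\<close>

primrec raw_skel_ty :: "raw_skel \<Rightarrow> ty" where
  "raw_skel_ty (RSVar x \<Gamma>) = env_type \<Gamma> x"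
| "raw_skel_ty (RSLam x Q) = TArr (env_type (raw_skel_env Q) x) (raw_skel_ty Q)"
| "raw_skel_ty (RSApp Q R) = cod_ty (raw_skel_ty Q)"
| "raw_skel_ty (RSAll a Q) = TAll a (raw_skel_ty Q)"
| "raw_skel_ty (RSExp s A Q) = TExp s A (raw_skel_ty Q)"
| "raw_skel_ty (RSCo Q T) = T"

lemma fmdom_raw_skel_env: "fmdom (raw_skel_env Q) |\<subseteq>| fv_raw_skel Q"
  by (induct Q) auto

lemma raw_skel_env_swap_tm: "raw_skel_env (swap_tm_raw_skel x y Q) = swap_dom x y (raw_skel_env Q)"
proof (induct Q)
  case (RSLam z Q)
  then show ?case by (intro fmap_ext) (auto simp: transpose_eq_iff)
next
  case (RSAll a Q)
  then show ?case by (intro fmap_ext) auto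
qed auto

lemma raw_skel_env_swap: "raw_skel_env (swap_raw_skel a b Q) = fmmap (swap_ty a b) (raw_skel_env Q)"
proof (induct Q)
  case (RSAll c Q)
  then show ?case by (auto simp: fmap.map_comp o_def)
qed auto

lemma ftv_raw_skel_env: "ftv_env (raw_skel_env Q) |\<subseteq>| ftv_raw_skel Q"
proof (induct Q)
  case (RSLam x Q)
  have "ftv_env (fmdrop x (raw_skel_env Q)) |\<subseteq>| ftv_env (raw_skel_env Q)"
    by (rule ftv_env_mono) (auto split: if_splits)
  with RSLam show ?case by (simp only: raw_skel_env.simps ftv_raw_skel.simps)
next
  case (RSAll a Q)
  have "ftv_env (fmmap (TAll a) (raw_skel_env Q)) |\<subseteq>| ftv_env (raw_skel_env Q) |-| {|a|}"
    unfolding fsubset_iff fminus_iff in_ftv_env by auto blast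
  with RSAll show ?case by (simp only: raw_skel_env.simps ftv_raw_skel.simps) blast
qed (auto simp del: fUnions_iff)

lemma raw_skel_ty_swap_tm: "raw_skel_ty (swap_tm_raw_skel x y Q) = raw_skel_ty Q"
  by (induct Q) (simp_all add: raw_skel_env_swap_tm env_type_def)

lemma raw_skel_ty_swap: "raw_skel_ty (swap_raw_skel a b Q) = swap_ty a b (raw_skel_ty Q)"
  by (induct Q) (simp_all add: raw_skel_env_swap env_type_swap cod_swap_ty)

lemma ftv_raw_skel_ty: "ftv_ty (raw_skel_ty Q) |\<subseteq>| ftv_raw_skel Q"
proof (induct Q)
  case (RSVar x \<Gamma>)
  then show ?case using ftv_env_type by simp
next
  case (RSLam x Q)
  then show ?case
    using ftv_env_type[of "raw_skel_env Q" x] ftv_raw_skel_env[of Q] by auto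
next
  case (RSApp Q R)
  then show ?case using ftv_cod_ty[of "raw_skel_ty Q"] by auto
qed auto

lemma raw_skel_env_eq: "skel_eq Q R \<Longrightarrow> raw_skel_env Q = raw_skel_env R"
proof (induct rule: skel_eq.induct)
  case (alpha_tm y Q x)
  \<comment> \<open>On each side one of \<open>x\<close> and \<open>y\<close> is dropped, and the
    other has no type because \<open>y\<close> is not assigned in the body.\<close>
  have "fmlookup (raw_skel_env Q) y = None"
    using alpha_tm fmdom_raw_skel_env[of Q] by (auto simp: fmdom_notD)
  then show ?case
    by (intro fmap_ext) (auto simp: raw_skel_env_swap_tm transpose_def)
next
  case (alpha_ty b Q a)
  \<comment> \<open>The bound type variable is renamed separately in each type of the
    environment.\<close>
  have "TAll a T = TAll b (swap_ty a b T)" if "fmlookup (raw_skel_env Q) x = Some T" for x T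
    using alpha_ty ftv_raw_skel_env[of Q] that
    by (intro TAll_alpha) (auto simp: in_ftv_env fsubset_iff simp del: fUnions_iff)
  then show ?case
    by (intro fmap_ext) (auto simp: raw_skel_env_swap option.map_comp intro!: option.map_cong0)
qed auto

lemma raw_skel_ty_eq: "skel_eq Q R \<Longrightarrow> raw_skel_ty Q = raw_skel_ty R"
proof (induct rule: skel_eq.induct)
  case (Lam Q R x)
  then show ?case by (simp add: raw_skel_env_eq)
next
  case (alpha_tm y Q x)
  then show ?case by (simp add: raw_skel_ty_swap_tm raw_skel_env_swap_tm env_type_def)
next
  case (alpha_ty b Q a)
  then have "b |\<notin>| ftv_ty (raw_skel_ty Q)" using ftv_raw_skel_ty[of Q] by auto
  then show ?case by (simp add: raw_skel_ty_swap TAll_alpha)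
qed auto

lift_definition skel_env :: "skel \<Rightarrow> env" is raw_skel_env by (rule raw_skel_env_eq)
lift_definition skel_ty :: "skel \<Rightarrow> ty" is raw_skel_ty by (rule raw_skel_ty_eq)

lemma skel_env_simps [simp]:
  "skel_env (SVar x \<Gamma>) = \<Gamma>"
  "skel_env (SLam x Q) = fmdrop x (skel_env Q)"
  "skel_env (SApp Q R) = skel_env Q"
  "skel_env (SAll a Q) = fmmap (TAll a) (skel_env Q)"
  "skel_env (SExp s A Q) = skel_env Q"
  "skel_env (SCo Q T) = skel_env Q"
       apply (simp add: SVar.abs_eq skel_env.abs_eq)
      apply (induct Q rule: skel.abs_induct, simp add: SLam.abs_eq skel_env.abs_eq)
     apply (induct Q rule: skel.abs_induct, induct R rule: skel.abs_induct,
      simp add: SApp.abs_eq skel_env.abs_eq)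
    apply (induct Q rule: skel.abs_induct, simp add: SAll.abs_eq skel_env.abs_eq)
   apply (induct Q rule: skel.abs_induct, simp add: SExp.abs_eq skel_env.abs_eq)
  apply (induct Q rule: skel.abs_induct, simp add: SCo.abs_eq skel_env.abs_eq)
  done

lemma skel_ty_simps [simp]:
  "skel_ty (SVar x \<Gamma>) = env_type \<Gamma> x"
  "skel_ty (SLam x Q) = TArr (env_type (skel_env Q) x) (skel_ty Q)"
  "skel_ty (SApp Q R) = cod_ty (skel_ty Q)"
  "skel_ty (SAll a Q) = TAll a (skel_ty Q)"
  "skel_ty (SExp s A Q) = TExp s A (skel_ty Q)"
  "skel_ty (SCo Q T) = T"
       apply (simp add: SVar.abs_eq skel_ty.abs_eq)
      apply (induct Q rule: skel.abs_induct, simp add: SLam.abs_eq skel_ty.abs_eq skel_env.abs_eq)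
     apply (induct Q rule: skel.abs_induct, induct R rule: skel.abs_induct,
      simp add: SApp.abs_eq skel_ty.abs_eq)
    apply (induct Q rule: skel.abs_induct, simp add: SAll.abs_eq skel_ty.abs_eq)
   apply (induct Q rule: skel.abs_induct, simp add: SExp.abs_eq skel_ty.abs_eq)
  apply (induct Q rule: skel.abs_induct, simp add: SCo.abs_eq skel_ty.abs_eq)
  done

text \<open>Environment and type are functions of the skeleton alone. This is the uniqueness behind
  the definite descriptions \<open>tenv\<close> and \<open>rtype\<close>, obtained without inverting
  equations between skeletons.\<close>

lemma typing_skel_env_ty:
  "Q \<triangleright> t : \<langle>\<Gamma> \<turnstile> T\<rangle>/C \<Longrightarrow> skel_env Q = \<Gamma> \<and> skel_ty Q = T"
proof (induct rule: typing.induct)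
  case (Lam x \<Gamma> Q t T1 T2 C)
  then show ?case by (auto simp: env_type_def intro!: fmap_ext dest: fmdom_notD)
next
  case (All Q t \<Gamma> T C a)
  then have "fmmap (TAll a) \<Gamma> = \<Gamma>"
    by (intro fmap_ext)
      (auto simp: in_ftv_env map_option_case TAll_vacuous simp del: fUnions_iff split: option.splits)
  with All show ?case by simp
qed (auto simp: env_type_def)

lemma typing_tenv: "Q \<triangleright> t : \<langle>\<Gamma> \<turnstile> T\<rangle>/C \<Longrightarrow> tenv Q = \<Gamma>"
  unfolding tenv_def by (rule the_equality) (blast, metis typing_skel_env_ty)

lemma typing_rtype: "Q \<triangleright> t : \<langle>\<Gamma> \<turnstile> T\<rangle>/C \<Longrightarrow> rtype Q = T"
  unfolding rtype_def by (rule the_equality) (blast, metis typing_skel_env_ty)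


section \<open>Inversion of typing\<close>

text \<open>Types and constraints contain no term variables, so swapping affects only skeleton, term
  and environment. It serves to rename the bound variable of an abstraction during
  inversion.\<close>

lemma typing_swap_tm:
  "Q \<triangleright> t : \<langle>\<Gamma> \<turnstile> T\<rangle>/C \<Longrightarrow> swap_tm_skel x y Q \<triangleright> swap_tm x y t : \<langle>swap_dom x y \<Gamma> \<turnstile> T\<rangle>/C"
proof (induct rule: typing.induct)
  case (Lam z \<Gamma> Q t T1 T2 C)
  have "transpose x y z |\<notin>| fmdom (swap_dom x y \<Gamma>)"
    unfolding fmdom_swap_dom fin_swap using Lam(1) by simp
  then show ?case
    unfolding swap_tm_skel_simps swap_tm_simps
    by (rule typing.Lam) (use Lam(3) in \<open>simp only: swap_dom_fmupd\<close>)
qed (auto intro!: typing.intros)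

lemma typing_fv: "Q \<triangleright> t : \<langle>\<Gamma> \<turnstile> T\<rangle>/C \<Longrightarrow> fv t |\<subseteq>| fmdom \<Gamma>"
  by (induct rule: typing.induct) (auto simp: fv_simps fmdomI)

lemma ftv_env_fmrestrict: "ftv_env (fmrestrict_fset X \<Gamma>) |\<subseteq>| ftv_env \<Gamma>"
  by (rule ftv_env_mono) (auto split: if_splits)

text \<open>The side conditions on quantifiers and E-variables bound the free type variables of the
  environment from above, so they survive restriction. The skeleton changes because its leaves carry
  whole environments.\<close>

lemma typing_strengthen:
  "Q \<triangleright> t : \<langle>\<Gamma> \<turnstile> T\<rangle>/C \<Longrightarrow> fv t |\<subseteq>| X \<Longrightarrow> \<exists>Q'. Q' \<triangleright> t : \<langle>fmrestrict_fset X \<Gamma> \<turnstile> T\<rangle>/C"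
proof (induct arbitrary: X rule: typing.induct)
  case (Var \<Gamma> x T)
  then show ?case
    by (intro exI[of _ "SVar x (fmrestrict_fset X \<Gamma>)"] typing.Var) (auto simp: fv_simps)
next
  case (Lam x \<Gamma> Q t T1 T2 C)
  have "fmrestrict_fset (finsert x X) (fmupd x T1 \<Gamma>) = fmupd x T1 (fmrestrict_fset X \<Gamma>)"
    by (rule fmap_ext) auto
  moreover have "fv t |\<subseteq>| finsert x X" using Lam by (auto simp: fv_simps)
  ultimately show ?case
    using Lam by (metis typing.Lam fmdom_notD fmdom_notI fmlookup_restrict_fset)
next
  case (App Q1 t1 \<Gamma> T1 T2 C1 Q2 t2 C2)
  then show ?case by (metis typing.App fv_simps(3) funion_fsubset_iff)
next
  case (All Q t \<Gamma> T C a)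
  then show ?case by (meson typing.All ftv_env_fmrestrict fsubsetD)
next
  case (Exp Q t \<Gamma> T C A s)
  then show ?case by (meson typing.Exp ftv_env_fmrestrict fsubset_trans)
next
  case (Co Q t \<Gamma> T1 C T2)
  then show ?case by (meson typing.Co)
qed

text \<open>Conclusions of the syntax-directed rules. Their skeleton is forgotten, since an instance
  of the initial skeleton will take its place.\<close>

inductive core_typing :: "tm \<Rightarrow> env \<Rightarrow> ty \<Rightarrow> constr \<Rightarrow> bool" where
  Var: "fmlookup \<Gamma> x = Some T \<Longrightarrow> core_typing (Var x) \<Gamma> T Omega"
| Lam: "x |\<notin>| fmdom \<Gamma> \<Longrightarrow> Q \<triangleright> t : \<langle>fmupd x T1 \<Gamma> \<turnstile> T2\<rangle>/C \<Longrightarrow>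
    core_typing (Lam x t) \<Gamma> (TArr T1 T2) C"
| App: "Q1 \<triangleright> t1 : \<langle>\<Gamma> \<turnstile> TArr T1 T2\<rangle>/C1 \<Longrightarrow> Q2 \<triangleright> t2 : \<langle>\<Gamma> \<turnstile> T1\<rangle>/C2 \<Longrightarrow>
    core_typing (App t1 t2) \<Gamma> T2 (C1 \<^bold>\<and> C2)"

lemma core_typing_VarE:
  assumes "core_typing (Var x) \<Gamma> T C"
  obtains "fmlookup \<Gamma> x = Some T" "C = Omega"
  using assms by cases auto

lemma core_typing_AppE:
  assumes "core_typing (App t1 t2) \<Gamma> T C"
  obtains Q1 Q2 T1 C1 C2 where "Q1 \<triangleright> t1 : \<langle>\<Gamma> \<turnstile> TArr T1 T\<rangle>/C1" "Q2 \<triangleright> t2 : \<langle>\<Gamma> \<turnstile> T1\<rangle>/C2"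
    "C = (C1 \<^bold>\<and> C2)"
  using assms by cases auto

text \<open>The rule may have been applied to another representative \<open>Lam y u\<close> of the
  abstraction; equivariance of typing carries its premise over to the given name
  \<open>x\<close>.\<close>

lemma core_typing_LamE:
  assumes "core_typing (Lam x t) \<Gamma> T C" "x |\<notin>| fmdom \<Gamma>"
  obtains Q T1 T2 where "Q \<triangleright> t : \<langle>fmupd x T1 \<Gamma> \<turnstile> T2\<rangle>/C" "T = TArr T1 T2"
  using assms(1)
proof cases
  case (Lam y Q u T1 T2)
  obtain F where F: "z |\<notin>| F \<Longrightarrow> swap_tm x z t = swap_tm y z u" for z
    using Lam_eqD[OF Lam(1)] by blast
  \<comment> \<open>Going from \<open>y\<close> to \<open>x\<close> through a fresh \<open>z\<close>
    takes \<open>u\<close> to \<open>t\<close>, and takes \<Gamma> extended at \<open>y\<close> to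
    \<Gamma> extended at \<open>x\<close>.\<close>
  obtain z where z: "z |\<notin>| F |\<union>| fmdom \<Gamma> |\<union>| {|x, y|}" using fresh_tmvar by blast
  have t: "swap_tm x z (swap_tm y z u) = t"
    using F[of z] z by (metis funionI1 swap_tm_involutory)
  have "swap_dom x z (swap_dom y z (fmupd y T1 \<Gamma>)) = fmupd x T1 \<Gamma>"
    using z Lam(3) assms(2) by (auto simp: swap_dom_fmupd swap_dom_fresh)
  then have "swap_tm_skel x z (swap_tm_skel y z Q) \<triangleright> t : \<langle>fmupd x T1 \<Gamma> \<turnstile> T2\<rangle>/C"
    using typing_swap_tm[OF typing_swap_tm[OF Lam(4)], of x z y z] by (simp only: t)
  then show thesis using that Lam(2) by blast
qed auto

text \<open>\<open>E\<close> collects the rules for quantifiers, E-variables and subtyping at the end of a derivation;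
  they can be applied after any other derivation of the core judgement, and turn additional
  reflexive constraints into reflexive constraints.\<close>

definition expands :: "expn \<Rightarrow> tm \<Rightarrow> env \<Rightarrow> ty \<Rightarrow> constr \<Rightarrow> ty \<Rightarrow> constr \<Rightarrow> bool" where
  "expands E t \<Gamma> T0 C0 T C \<longleftrightarrow> expand_ty E (ftv_env \<Gamma>) T0 = T \<and>
    (\<forall>R D. R \<triangleright> t : \<langle>\<Gamma> \<turnstile> T0\<rangle>/(C0 \<^bold>\<and> D) \<longrightarrow> reflexive_constr D \<longrightarrow>
      (\<exists>D'. reflexive_constr D' \<and> expand_skel E (ftv_env \<Gamma>) R \<triangleright> t : \<langle>\<Gamma> \<turnstile> T\<rangle>/(C \<^bold>\<and> D')))"

lemma expands_step:
  assumes "expands E t \<Gamma> T0 C0 T C" "expand_ty E' (ftv_env \<Gamma>) T0 = T'"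
    and "\<And>R D. expand_skel E (ftv_env \<Gamma>) R \<triangleright> t : \<langle>\<Gamma> \<turnstile> T\<rangle>/(C \<^bold>\<and> D) \<Longrightarrow> reflexive_constr D \<Longrightarrow>
      \<exists>D'. reflexive_constr D' \<and> expand_skel E' (ftv_env \<Gamma>) R \<triangleright> t : \<langle>\<Gamma> \<turnstile> T'\<rangle>/(C' \<^bold>\<and> D')"
  shows "expands E' t \<Gamma> T0 C0 T' C'"
  using assms unfolding expands_def by blast

lemma expands_Eps: "expands Eps t \<Gamma> T C T C"
  unfolding expands_def by auto

text \<open>The side condition on \<open>a\<close> also selects the quantifying branch of expansion
  application. Distributing the existential over the conjunction separates the reflexive part
  again.\<close>

lemma expands_EAll:
  assumes "expands E t \<Gamma> T0 C0 T C" "a |\<notin>| ftv_env \<Gamma>"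
  shows "expands (EAll a E) t \<Gamma> T0 C0 (TAll a T) (CEx a C)"
proof (rule expands_step[OF assms(1)])
  show "expand_ty (EAll a E) (ftv_env \<Gamma>) T0 = TAll a T"
    using assms by (simp add: expands_def del: fUnions_iff)
next
  fix R D assume *: "expand_skel E (ftv_env \<Gamma>) R \<triangleright> t : \<langle>\<Gamma> \<turnstile> T\<rangle>/(C \<^bold>\<and> D)" "reflexive_constr D"
  from typing.All[OF *(1) assms(2)] assms(2) *(2)
  show "\<exists>D'. reflexive_constr D' \<and>
      expand_skel (EAll a E) (ftv_env \<Gamma>) R \<triangleright> t : \<langle>\<Gamma> \<turnstile> TAll a T\<rangle>/(CEx a C \<^bold>\<and> D')"
    by (intro exI[of _ "CEx a D"]) (simp add: CEx_Conj reflexive_constr.intros del: fUnions_iff)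
qed

lemma expands_EExp:
  assumes "expands E t \<Gamma> T0 C0 T C" "ftv_env \<Gamma> |\<subseteq>| A"
  shows "expands (EExp s A E) t \<Gamma> T0 C0 (TExp s A T) (CExp s A T C)"
proof (rule expands_step[OF assms(1)])
  \<comment> \<open>Expansion application adds the free variables of the environment to the label;
    the side condition says that \<open>A\<close> already contains them.\<close>
  have A: "ftv_env \<Gamma> |\<union>| A = A" using assms(2) by (simp add: sup.absorb2)
  show "expand_ty (EExp s A E) (ftv_env \<Gamma>) T0 = TExp s A T"
    using assms(1) by (simp add: expands_def A)
  fix R D assume *: "expand_skel E (ftv_env \<Gamma>) R \<triangleright> t : \<langle>\<Gamma> \<turnstile> T\<rangle>/(C \<^bold>\<and> D)" "reflexive_constr D"
  from typing.Exp[OF *(1) assms(2)] *(2)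
  show "\<exists>D'. reflexive_constr D' \<and>
      expand_skel (EExp s A E) (ftv_env \<Gamma>) R \<triangleright> t : \<langle>\<Gamma> \<turnstile> TExp s A T\<rangle>/(CExp s A T C \<^bold>\<and> D')"
    by (intro exI[of _ "CExp s A T D"]) (simp add: CExp_Conj A reflexive_constr.intros)
qed

lemma expands_ECo:
  assumes "expands E t \<Gamma> T0 C0 T C"
  shows "expands (ECo E T') t \<Gamma> T0 C0 T' (C \<^bold>\<and> T \<lessdot> T')"
proof (rule expands_step[OF assms])
  fix R D assume *: "expand_skel E (ftv_env \<Gamma>) R \<triangleright> t : \<langle>\<Gamma> \<turnstile> T\<rangle>/(C \<^bold>\<and> D)" "reflexive_constr D"
  from typing.Co[OF *(1), of T'] *(2)
  show "\<exists>D'. reflexive_constr D' \<and>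
      expand_skel (ECo E T') (ftv_env \<Gamma>) R \<triangleright> t : \<langle>\<Gamma> \<turnstile> T'\<rangle>/(C \<^bold>\<and> T \<lessdot> T' \<^bold>\<and> D')"
    by (intro exI[of _ D]) (simp add: Conj_ac)
qed simp

text \<open>A syntax-directed last rule gives the expansion \<open>Eps\<close>; every other rule
  adds one constructor to the expansion of its premise.\<close>

lemma typing_core:
  "Q \<triangleright> t : \<langle>\<Gamma> \<turnstile> T\<rangle>/C \<Longrightarrow> \<exists>E T0 C0. core_typing t \<Gamma> T0 C0 \<and> expands E t \<Gamma> T0 C0 T C"
  by (induct rule: typing.induct)
    (blast intro: core_typing.intros expands_Eps expands_EAll expands_EExp expands_ECo)+


section \<open>Instances of initial skeletons\<close>

lemma variable_env_lookup:
  "variable_env \<Xi> \<Longrightarrow> fmlookup \<Xi> x = Some T \<Longrightarrow> \<exists>a. T = TVar a"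
  unfolding variable_env_def by (metis fmdomI option.inject)

lemma variable_env_fmupd_fresh:
  assumes "variable_env (fmupd x (TVar a) \<Xi>)" "x |\<notin>| fmdom \<Xi>"
  shows "a |\<notin>| ftv_env \<Xi>"
proof
  assume "a |\<in>| ftv_env \<Xi>"
  then obtain y T where y: "fmlookup \<Xi> y = Some T" "a |\<in>| ftv_ty T" unfolding in_ftv_env by blast
  obtain f where f: "inj_on f (fset (fmdom (fmupd x (TVar a) \<Xi>)))"
    "\<And>z. z |\<in>| fmdom (fmupd x (TVar a) \<Xi>) \<Longrightarrow>
      fmlookup (fmupd x (TVar a) \<Xi>) z = Some (TVar (f z))"
    using assms(1) unfolding variable_env_def by blast
  have xy: "x \<noteq> y" "y |\<in>| fmdom \<Xi>" using y(1) assms(2) by (auto simp: fmdomI)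
  have "T = TVar (f y)" "TVar a = TVar (f x)" using f(2)[of y] f(2)[of x] xy y(1) by auto
  \<comment> \<open>Equal type variables are recovered from equal types by comparing free
    variables.\<close>
  then have "ftv_ty (TVar (f y)) = {|f y|}" "a = f x" "f y = a"
    using y(2) by (auto dest: arg_cong[of _ _ ftv_ty])
  with f(1) xy show False by (auto simp: inj_on_def)
qed

text \<open>All types in \<Xi> are variables. Hence the label \<open>ftv_env \<Xi>\<close> in an
  initial skeleton becomes exactly the parameter at which \<open>expands\<close> applies its
  expansion.\<close>

lemma ftv_subst_image_variable_env:
  assumes "variable_env \<Xi>"
  shows "ftv_subst_image \<sigma> (ftv_env \<Xi>) = ftv_env (subst_env \<sigma> \<Xi>)"
proof (rule fset_eqI)
  fix c
  have "c |\<in>| ftv_env (subst_env \<sigma> \<Xi>) \<longleftrightarrow>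
      (\<exists>x T. fmlookup \<Xi> x = Some T \<and> c |\<in>| ftv_ty (subst_ty \<sigma> T))"
    unfolding in_ftv_env by auto
  also have "\<dots> \<longleftrightarrow>
      (\<exists>x a. fmlookup \<Xi> x = Some (TVar a) \<and> c |\<in>| ftv_ty (subst_tyvar \<sigma> a))"
    using variable_env_lookup[OF assms] by (metis subst_ty_simps(1))
  moreover have "c |\<in>| ftv_subst_image \<sigma> (ftv_env \<Xi>) \<longleftrightarrow>
      (\<exists>x a. fmlookup \<Xi> x = Some (TVar a) \<and> c |\<in>| ftv_ty (subst_tyvar \<sigma> a))"
    unfolding fUnions_iff[of c] in_ftv_env using variable_env_lookup[OF assms]
    by (metis ftv_ty_simps(1) fsingleton_iff)
  ultimately show "c |\<in>| ftv_subst_image \<sigma> (ftv_env \<Xi>) \<longleftrightarrow> c |\<in>| ftv_env (subst_env \<sigma> \<Xi>)" by blast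
qed

lemma subst_env_cong_variable_env:
  assumes "variable_env \<Xi>" "\<And>a. a |\<in>| ftv_env \<Xi> \<Longrightarrow> subst_tyvar \<sigma> a = subst_tyvar \<sigma>' a"
  shows "subst_env \<sigma> \<Xi> = subst_env \<sigma>' \<Xi>"
proof (rule fmap_ext)
  fix x
  show "fmlookup (subst_env \<sigma> \<Xi>) x = fmlookup (subst_env \<sigma>' \<Xi>) x"
  proof (cases "fmlookup \<Xi> x")
    case (Some T)
    then obtain a where "T = TVar a" using variable_env_lookup assms(1) by blast
    with Some assms(2)[of a] show ?thesis by (force simp: subst_ty_simps(1) in_ftv_env simp del: fUnions_iff)
  qed simp
qed

text \<open>By injectivity, a newly added assignment never shadows an earlier one.\<close>

lemma ex_subst_image_of_inj:
  assumes "inj_on f (fset X)"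
  shows "\<exists>\<sigma>. \<forall>x. x |\<in>| X \<longrightarrow> subst_tyvar \<sigma> (f x) = g x"
  using assms
proof (induct X)
  case (insert x X)
  then obtain \<sigma> where "\<forall>y. y |\<in>| X \<longrightarrow> subst_tyvar \<sigma> (f y) = g y" by auto
  with insert show ?case by (intro exI[of _ "STy (f x) (g x) \<sigma>"]) (auto simp: inj_on_def)
qed simp

lemma ex_subst_variable_env:
  assumes "variable_env \<Xi>" "fmdom \<Gamma> = fmdom \<Xi>"
  shows "\<exists>\<sigma>. subst_env \<sigma> \<Xi> = \<Gamma>"
proof -
  obtain f where f: "inj_on f (fset (fmdom \<Xi>))"
    "\<And>x. x |\<in>| fmdom \<Xi> \<Longrightarrow> fmlookup \<Xi> x = Some (TVar (f x))"
    using assms(1) unfolding variable_env_def by blast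
  obtain \<sigma> where \<sigma>: "\<And>x. x |\<in>| fmdom \<Xi> \<Longrightarrow> subst_tyvar \<sigma> (f x) = the (fmlookup \<Gamma> x)"
    using ex_subst_image_of_inj[OF f(1), of "\<lambda>x. the (fmlookup \<Gamma> x)"] by blast
  have "fmlookup (subst_env \<sigma> \<Xi>) x = fmlookup \<Gamma> x" for x
  proof (cases "x |\<in>| fmdom \<Xi>")
    case True
    then obtain T where "fmlookup \<Gamma> x = Some T" using assms(2) by (metis fmdomE)
    with True show ?thesis by (simp add: f(2) \<sigma> subst_ty_simps(1))
  next
    case False
    then show ?thesis using assms(2) by (simp add: fmdom_notD)
  qed
  then show ?thesis by (metis fmap_ext)
qed

text \<open>Validity makes \<open>tenv\<close> and \<open>rtype\<close> computable, so every label
  turns out to be \<open>ftv_env \<Xi>\<close>. The inclusion lets agreement on the variables of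
  \<open>Q\<close> yield agreement on \<Xi>.\<close>

lemma init_typing:
  "init \<Xi> t Q \<Longrightarrow> variable_env \<Xi> \<and> ftv_env \<Xi> |\<subseteq>| ftv_skel Q \<and> (\<exists>T C. Q \<triangleright> t : \<langle>\<Xi> \<turnstile> T\<rangle>/C)"
proof (induct rule: init.induct)
  case (Var \<Xi> x s)
  then show ?case by (auto simp del: fUnions_iff elim!: fmdomE intro: typing.intros)
next
  case (Lam \<Xi> x a t Q s A)
  then obtain T C where "SLam x Q \<triangleright> Lam x t : \<langle>\<Xi> \<turnstile> TArr (TVar a) T\<rangle>/C"
    by (metis typing.Lam)
  with typing_tenv[OF this] Lam show ?case
    by (auto simp: ftv_env_fmupd simp del: fUnions_iff intro!: exI typing.Exp)
next
  case (App \<Xi> t1 Q1 t2 Q2 Q a A s)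
  then obtain T1 C1 T2 C2 where *: "Q1 \<triangleright> t1 : \<langle>\<Xi> \<turnstile> T1\<rangle>/C1" "Q2 \<triangleright> t2 : \<langle>\<Xi> \<turnstile> T2\<rangle>/C2"
    by blast
  have "Q \<triangleright> App t1 t2 : \<langle>\<Xi> \<turnstile> TVar a\<rangle>/(C1 \<^bold>\<and> T1 \<lessdot> TArr T2 (TVar a) \<^bold>\<and> C2)"
    unfolding App(6) typing_rtype[OF *(2)]
    by (rule typing.App[OF typing.Co[OF *(1)] *(2)])
  with typing_tenv[OF this] App show ?case
    by (auto simp del: fUnions_iff intro!: exI typing.Exp)
qed

text \<open>Treats both sorts of variables at once, matching the sum type used by
  \<open>var_skel\<close>.\<close>

definition subst_val :: "subst \<Rightarrow> tyvar + evar \<Rightarrow> ty + expn" where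
  "subst_val \<sigma> = map_sum (subst_tyvar \<sigma>) (subst_evar \<sigma>)"

lemma subst_val_simps [simp]:
  "subst_val \<sigma> (Inl a) = Inl (subst_tyvar \<sigma> a)"
  "subst_val \<sigma> (Inr s) = Inr (subst_evar \<sigma> s)"
  by (simp_all add: subst_val_def)

lemma subst_val_upd:
  "v \<noteq> Inl a \<Longrightarrow> subst_val (STy a T \<sigma>) v = subst_val \<sigma> v"
  "v \<noteq> Inr s \<Longrightarrow> subst_val (SEv s E \<sigma>) v = subst_val \<sigma> v"
  by (cases v; simp)+

lemma Inl_in_var_skel [simp]: "Inl a |\<in>| var_skel Q \<longleftrightarrow> a |\<in>| ftv_skel Q"
  by (auto simp: var_skel_def)

lemma Inr_in_var_skel [simp]: "Inr s |\<in>| var_skel Q \<longleftrightarrow> s |\<in>| evs_skel Q"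
  by (auto simp: var_skel_def)

text \<open>The equation for \<open>rtype\<close> is carried along with the judgement, because the
  coercion at an application mentions the \<open>rtype\<close> of the argument and has to be
  evaluated under \<sigma>.\<close>

definition instantiates :: "subst \<Rightarrow> skel \<Rightarrow> tm \<Rightarrow> env \<Rightarrow> ty \<Rightarrow> constr \<Rightarrow> bool" where
  "instantiates \<sigma> Q t \<Gamma> T C \<longleftrightarrow> subst_ty \<sigma> (rtype Q) = T \<and>
    (\<exists>D. reflexive_constr D \<and> subst_skel \<sigma> Q \<triangleright> t : \<langle>\<Gamma> \<turnstile> T\<rangle>/(C \<^bold>\<and> D))"

text \<open>Substitution replaces the outermost E-variable by \<open>E\<close>, applied at the free
  variables of \<Gamma> to the instance of \<open>P\<close>; this is the situation that
  \<open>expands\<close> describes.\<close>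

lemma instantiates_SExp:
  assumes "variable_env \<Xi>" "subst_env \<sigma> \<Xi> = \<Gamma>" "subst_evar \<sigma> s = E"
    and "P \<triangleright> t : \<langle>\<Xi> \<turnstile> S\<rangle>/B" "subst_ty \<sigma> S = T0" "expands E t \<Gamma> T0 C0 T C"
    and "reflexive_constr D" "subst_skel \<sigma> P \<triangleright> t : \<langle>\<Gamma> \<turnstile> T0\<rangle>/(C0 \<^bold>\<and> D)"
  shows "instantiates \<sigma> (SExp s (ftv_env \<Xi>) P) t \<Gamma> T C"
proof -
  have "rtype (SExp s (ftv_env \<Xi>) P) = TExp s (ftv_env \<Xi>) S"
    by (rule typing_rtype[OF typing.Exp[OF assms(4) order_refl]])
  then show ?thesis
    using assms(2,3,5-8)
    by (auto simp add: instantiates_def expands_def subst_ty_simps(4) subst_skel_simps(5)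
        ftv_subst_image_variable_env[OF assms(1)] del: fUnions_iff)
qed

text \<open>Letting the conclusion hold for every substitution that agrees with \<open>\<sigma>\<close> on the variables
  of \<open>Q\<close>, and letting \<open>\<sigma>\<close> differ from \<open>\<sigma>0\<close> only on those variables, makes it possible to
  thread the substitution through the two branches of an application instead of merging two.\<close>

lemma init_instance:
  assumes "init \<Xi> t Q" "Q' \<triangleright> t : \<langle>subst_env \<sigma>0 \<Xi> \<turnstile> T\<rangle>/C"
  shows "\<exists>\<sigma>. (\<forall>v. v |\<notin>| var_skel Q |-| Inl |`| ftv_env \<Xi> \<longrightarrow> subst_val \<sigma> v = subst_val \<sigma>0 v) \<and>
    (\<forall>\<sigma>'. (\<forall>v. v |\<in>| var_skel Q \<longrightarrow> subst_val \<sigma>' v = subst_val \<sigma> v) \<longrightarrow>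
      instantiates \<sigma>' Q t (subst_env \<sigma>0 \<Xi>) T C)"
  using assms
proof (induct arbitrary: Q' \<sigma>0 T C rule: init.induct)
  case (Var \<Xi> x s)
  define \<Gamma> where "\<Gamma> = subst_env \<sigma>0 \<Xi>"
  obtain E T0 C0 where core: "core_typing (Var x) \<Gamma> T0 C0"
    and E: "expands E (Var x) \<Gamma> T0 C0 T C"
    using typing_core[OF Var(3)] unfolding \<Gamma>_def by blast
  from core have T0: "fmlookup \<Gamma> x = Some T0" and C0: "C0 = Omega"
    by (auto elim: core_typing_VarE)
  from T0 obtain S where S: "fmlookup \<Xi> x = Some S" unfolding \<Gamma>_def by auto
  let ?Q = "SExp s (ftv_env \<Xi>) (SVar x \<Xi>)"
  \<comment> \<open>The witness is \<sigma>0 with \<open>s\<close> sent to the expansion that ends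
    the given derivation.\<close>
  have "instantiates \<sigma>' ?Q (Var x) \<Gamma> T C"
    if \<sigma>': "\<forall>v. v |\<in>| var_skel ?Q \<longrightarrow> subst_val \<sigma>' v = subst_val (SEv s E \<sigma>0) v" for \<sigma>'
  proof -
    have "subst_tyvar \<sigma>' a = subst_tyvar \<sigma>0 a" if "a |\<in>| ftv_env \<Xi>" for a
      using \<sigma>'[rule_format, of "Inl a"] that by (simp del: fUnions_iff)
    then have env: "subst_env \<sigma>' \<Xi> = \<Gamma>"
      unfolding \<Gamma>_def by (rule subst_env_cong_variable_env[OF Var(1)])
    have s: "subst_evar \<sigma>' s = E" using \<sigma>'[rule_format, of "Inr s"] by simp
    have ty: "subst_ty \<sigma>' S = T0" using T0 S unfolding env[symmetric] by simp
    have "subst_skel \<sigma>' (SVar x \<Xi>) \<triangleright> Var x : \<langle>\<Gamma> \<turnstile> T0\<rangle>/(C0 \<^bold>\<and> Omega)"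
      unfolding C0 Conj_Omega subst_skel_simps env using T0 by (rule typing.Var)
    then show ?thesis
      by (rule instantiates_SExp[OF Var(1) env s typing.Var[OF S] ty E
            reflexive_constr.intros(1)])
  qed
  then show ?case unfolding \<Gamma>_def[symmetric]
    by (intro exI[of _ "SEv s E \<sigma>0"]) (auto simp del: fUnions_iff intro!: subst_val_upd)
next
  case (Lam \<Xi> x a t Q s A)
  define \<Gamma> where "\<Gamma> = subst_env \<sigma>0 \<Xi>"
  obtain E T0 C0 where core: "core_typing (Lam x t) \<Gamma> T0 C0"
    and E: "expands E (Lam x t) \<Gamma> T0 C0 T C"
    using typing_core[OF Lam(8)] unfolding \<Gamma>_def by blast
  have x: "x |\<notin>| fmdom \<Gamma>" using Lam(2) by (simp add: \<Gamma>_def)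
  obtain R T1 T2 where R: "R \<triangleright> t : \<langle>fmupd x T1 \<Gamma> \<turnstile> T2\<rangle>/C0" and T0: "T0 = TArr T1 T2"
    using core_typing_LamE[OF core x] .
  have a: "a |\<notin>| ftv_env \<Xi>" by (rule variable_env_fmupd_fresh[OF Lam(3,2)])
  \<comment> \<open>As \<open>a\<close> does not occur in \<Xi>, sending it to the parameter type
    \<open>T1\<close> leaves the image of \<Xi> unchanged.\<close>
  have upd: "subst_env (STy a T1 \<sigma>0) \<Xi> = \<Gamma>"
    unfolding \<Gamma>_def using a by (intro subst_env_cong_variable_env[OF Lam(1)]) auto
  then have upd': "subst_env (STy a T1 \<sigma>0) (fmupd x (TVar a) \<Xi>) = fmupd x T1 \<Gamma>"
    by (simp only: fmmap_fmupd) (simp add: subst_ty_simps(1))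
  \<comment> \<open>The induction hypothesis starts from the substitution that already maps the
    extended variable environment to that of the body.\<close>
  from Lam(5)[of R "STy a T1 \<sigma>0" T2 C0] R obtain \<sigma> where
    \<sigma>: "\<And>v. v |\<notin>| var_skel Q |-| Inl |`| ftv_env (fmupd x (TVar a) \<Xi>) \<Longrightarrow>
      subst_val \<sigma> v = subst_val (STy a T1 \<sigma>0) v"
    and inst: "\<And>\<sigma>'. (\<forall>v. v |\<in>| var_skel Q \<longrightarrow> subst_val \<sigma>' v = subst_val \<sigma> v) \<Longrightarrow>
      instantiates \<sigma>' Q t (fmupd x T1 \<Gamma>) T2 C0"
    unfolding upd' by blast
  obtain S B where S: "Q \<triangleright> t : \<langle>fmupd x (TVar a) \<Xi> \<turnstile> S\<rangle>/B"
    and ftvQ: "finsert a (ftv_env \<Xi>) |\<subseteq>| ftv_skel Q"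
    using init_typing[OF Lam(4)] unfolding ftv_env_fmupd[OF Lam(2)] by auto
  note SL = typing.Lam[OF Lam(2) S]
  have A: "A = ftv_env \<Xi>" unfolding Lam(7) typing_tenv[OF SL] ..
  let ?Q = "SExp s (ftv_env \<Xi>) (SLam x Q)"
  have "instantiates \<sigma>' ?Q (Lam x t) \<Gamma> T C"
    if \<sigma>': "\<forall>v. v |\<in>| var_skel ?Q \<longrightarrow> subst_val \<sigma>' v = subst_val (SEv s E \<sigma>) v" for \<sigma>'
  proof -
    have s: "subst_evar \<sigma>' s = E" using \<sigma>'[rule_format, of "Inr s"] by simp
    have agree: "subst_val \<sigma>' v = subst_val \<sigma> v" if "v |\<in>| var_skel Q" for v
    proof -
      have "v |\<in>| var_skel ?Q" using that by (auto simp: var_skel_def)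
      moreover have "v \<noteq> Inr s" using that Lam(6) by blast
      ultimately show ?thesis using \<sigma>' by (simp add: subst_val_upd)
    qed
    \<comment> \<open>The variables of the extended environment are exempt from change in the
      induction hypothesis, so \<open>a\<close> keeps the value \<open>T1\<close>.\<close>
    have *: "subst_tyvar \<sigma>' b = subst_tyvar (STy a T1 \<sigma>0) b" if "b |\<in>| finsert a (ftv_env \<Xi>)" for b
      using agree[of "Inl b"] \<sigma>[of "Inl b"] ftvQ that unfolding ftv_env_fmupd[OF Lam(2)]
      by (auto simp del: fUnions_iff)
    then have "subst_env \<sigma>' \<Xi> = subst_env (STy a T1 \<sigma>0) \<Xi>"
      by (intro subst_env_cong_variable_env[OF Lam(1)]) blast
    with upd have env: "subst_env \<sigma>' \<Xi> = \<Gamma>" by simp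
    obtain D where inst': "subst_ty \<sigma>' S = T2" "reflexive_constr D"
      "subst_skel \<sigma>' Q \<triangleright> t : \<langle>fmupd x T1 \<Gamma> \<turnstile> T2\<rangle>/(C0 \<^bold>\<and> D)"
      using inst[of \<sigma>'] agree unfolding instantiates_def typing_rtype[OF S] by blast
    have ty: "subst_ty \<sigma>' (TArr (TVar a) S) = T0"
      using *[of a] by (simp add: subst_ty_simps(1,2) T0 inst'(1))
    have "subst_skel \<sigma>' (SLam x Q) \<triangleright> Lam x t : \<langle>\<Gamma> \<turnstile> T0\<rangle>/(C0 \<^bold>\<and> D)"
      unfolding subst_skel_simps T0 using x inst'(3) by (rule typing.Lam)
    then show ?thesis
      by (rule instantiates_SExp[OF Lam(1) env s SL ty E inst'(2)])
  qed
  moreover have "subst_val (SEv s E \<sigma>) v = subst_val \<sigma>0 v"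
    if v: "v |\<notin>| var_skel ?Q |-| Inl |`| ftv_env \<Xi>" for v
  proof -
    have "v \<noteq> Inr s" "v \<noteq> Inl a" using v a ftvQ by (auto simp del: fUnions_iff)
    moreover have "v |\<notin>| var_skel Q |-| Inl |`| ftv_env (fmupd x (TVar a) \<Xi>)"
      using v unfolding ftv_env_fmupd[OF Lam(2)] by (auto simp: var_skel_def simp del: fUnions_iff)
    ultimately show ?thesis using \<sigma>[of v] by (simp add: subst_val_upd)
  qed
  ultimately show ?case unfolding \<Gamma>_def[symmetric] A by blast
next
  case (App \<Xi> t1 Q1 t2 Q2 P a A s)
  define \<Gamma> where "\<Gamma> = subst_env \<sigma>0 \<Xi>"
  obtain E T0 C0 where core: "core_typing (App t1 t2) \<Gamma> T0 C0"
    and E: "expands E (App t1 t2) \<Gamma> T0 C0 T C"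
    using typing_core[OF App(10)] unfolding \<Gamma>_def by blast
  obtain R1 R2 T1 C1 C2 where R: "R1 \<triangleright> t1 : \<langle>\<Gamma> \<turnstile> TArr T1 T0\<rangle>/C1" "R2 \<triangleright> t2 : \<langle>\<Gamma> \<turnstile> T1\<rangle>/C2"
    and C0: "C0 = (C1 \<^bold>\<and> C2)"
    using core_typing_AppE[OF core] .
  from App(3)[OF R(1)[unfolded \<Gamma>_def]] obtain \<sigma>1 where
    \<sigma>1: "\<And>v. v |\<notin>| var_skel Q1 |-| Inl |`| ftv_env \<Xi> \<Longrightarrow> subst_val \<sigma>1 v = subst_val \<sigma>0 v"
    and inst1: "\<And>\<sigma>'. (\<forall>v. v |\<in>| var_skel Q1 \<longrightarrow> subst_val \<sigma>' v = subst_val \<sigma>1 v) \<Longrightarrow>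
      instantiates \<sigma>' Q1 t1 \<Gamma> (TArr T1 T0) C1"
    unfolding \<Gamma>_def by blast
  \<comment> \<open>The first branch does not change the values on \<Xi>, so the second branch can
    start from \<sigma>1 with the same \<Gamma>.\<close>
  have env1: "subst_env \<sigma>1 \<Xi> = \<Gamma>"
    unfolding \<Gamma>_def
  proof (rule subst_env_cong_variable_env[OF App(1)])
    fix b assume "b |\<in>| ftv_env \<Xi>"
    then show "subst_tyvar \<sigma>1 b = subst_tyvar \<sigma>0 b" using \<sigma>1[of "Inl b"] by (simp del: fUnions_iff)
  qed
  from App(5)[of R2 \<sigma>1 T1 C2] R(2) obtain \<sigma>2 where
    \<sigma>2: "\<And>v. v |\<notin>| var_skel Q2 |-| Inl |`| ftv_env \<Xi> \<Longrightarrow> subst_val \<sigma>2 v = subst_val \<sigma>1 v"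
    and inst2: "\<And>\<sigma>'. (\<forall>v. v |\<in>| var_skel Q2 \<longrightarrow> subst_val \<sigma>' v = subst_val \<sigma>2 v) \<Longrightarrow>
      instantiates \<sigma>' Q2 t2 \<Gamma> T1 C2"
    unfolding env1 by blast
  obtain S1 B1 S2 B2 where S: "Q1 \<triangleright> t1 : \<langle>\<Xi> \<turnstile> S1\<rangle>/B1" "Q2 \<triangleright> t2 : \<langle>\<Xi> \<turnstile> S2\<rangle>/B2"
    and ftvQ: "ftv_env \<Xi> |\<subseteq>| ftv_skel Q1"
    using init_typing[OF App(2)] init_typing[OF App(4)] by blast
  have P: "P = SApp (SCo Q1 (TArr S2 (TVar a))) Q2" unfolding App(6) typing_rtype[OF S(2)] ..
  have SP: "P \<triangleright> App t1 t2 : \<langle>\<Xi> \<turnstile> TVar a\<rangle>/(B1 \<^bold>\<and> S1 \<lessdot> TArr S2 (TVar a) \<^bold>\<and> B2)"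
    unfolding P by (rule typing.App[OF typing.Co[OF S(1)] S(2)])
  have A: "A = ftv_env \<Xi>" unfolding App(7) typing_tenv[OF SP] ..
  have new: "Inl a |\<notin>| var_skel Q1" "Inl a |\<notin>| var_skel Q2" "Inr s |\<notin>| var_skel Q1" "Inr s |\<notin>| var_skel Q2"
    using App(9) by (auto simp: fset_eq_iff)
  \<comment> \<open>Both \<open>a\<close> and \<open>s\<close> are new for the two branches, so
    assigning the result type and the expansion disturbs neither.\<close>
  define \<sigma> where "\<sigma> = STy a T0 (SEv s E \<sigma>2)"
  have \<sigma>: "subst_val \<sigma> v = subst_val \<sigma>2 v" if "v \<noteq> Inl a" "v \<noteq> Inr s" for v
    using that by (simp add: \<sigma>_def subst_val_upd)
  let ?Q = "SExp s (ftv_env \<Xi>) P"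
  have sub: "v |\<in>| var_skel ?Q" if "v |\<in>| var_skel Q1 |\<union>| var_skel Q2 |\<union>| {|Inl a, Inr s|}" for v
    using that by (auto simp: var_skel_def P)
  have "instantiates \<sigma>' ?Q (App t1 t2) \<Gamma> T C"
    if \<sigma>': "\<forall>v. v |\<in>| var_skel ?Q \<longrightarrow> subst_val \<sigma>' v = subst_val \<sigma> v" for \<sigma>'
  proof -
    have s: "subst_evar \<sigma>' s = E"
      using \<sigma>'[rule_format, OF sub, of "Inr s"] by (simp add: \<sigma>_def)
    have a: "subst_tyvar \<sigma>' a = T0"
      using \<sigma>'[rule_format, OF sub, of "Inl a"] by (simp add: \<sigma>_def)
    have agree2: "subst_val \<sigma>' v = subst_val \<sigma>2 v" if "v |\<in>| var_skel Q1 |\<union>| var_skel Q2" for v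
    proof -
      have "v \<noteq> Inl a" "v \<noteq> Inr s" using that new by blast+
      with \<sigma>[of v] \<sigma>'[rule_format, OF sub, of v] that show ?thesis by auto
    qed
    \<comment> \<open>A variable shared by \<open>Q1\<close> and \<open>Q2\<close> occurs in \<Xi>,
      where \<sigma>2 still has the value of \<sigma>1.\<close>
    have agree1: "subst_val \<sigma>' v = subst_val \<sigma>1 v" if "v |\<in>| var_skel Q1" for v
    proof -
      have "v |\<notin>| var_skel Q2 |-| Inl |`| ftv_env \<Xi>"
        using that App(8) unfolding fset_eq_iff by blast
      with \<sigma>2[of v] agree2[of v] that show ?thesis by simp
    qed
    have "subst_tyvar \<sigma>' b = subst_tyvar \<sigma>1 b" if "b |\<in>| ftv_env \<Xi>" for b
      using agree1[of "Inl b"] that ftvQ by (auto simp del: fUnions_iff)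
    then have "subst_env \<sigma>' \<Xi> = subst_env \<sigma>1 \<Xi>"
      by (rule subst_env_cong_variable_env[OF App(1)])
    with env1 have env: "subst_env \<sigma>' \<Xi> = \<Gamma>" by simp
    obtain D1 where 1: "reflexive_constr D1"
      "subst_skel \<sigma>' Q1 \<triangleright> t1 : \<langle>\<Gamma> \<turnstile> TArr T1 T0\<rangle>/(C1 \<^bold>\<and> D1)"
      using inst1[of \<sigma>'] agree1 unfolding instantiates_def by blast
    obtain D2 where 2: "subst_ty \<sigma>' S2 = T1" "reflexive_constr D2"
      "subst_skel \<sigma>' Q2 \<triangleright> t2 : \<langle>\<Gamma> \<turnstile> T1\<rangle>/(C2 \<^bold>\<and> D2)"
      using inst2[of \<sigma>'] agree2 unfolding instantiates_def typing_rtype[OF S(2)] by blast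
    have ty: "subst_ty \<sigma>' (TVar a) = T0" by (simp add: subst_ty_simps(1) a)
    \<comment> \<open>The target of the coercion becomes the type that the instance of
      \<open>Q1\<close> already has, so the added constraint \<open>L\<close> is reflexive.\<close>
    have co: "subst_ty \<sigma>' (TArr S2 (TVar a)) = TArr T1 T0" by (simp add: subst_ty_simps(2) 2(1) ty)
    define L where "L = TArr T1 T0 \<lessdot> TArr T1 T0"
    have "subst_skel \<sigma>' P \<triangleright> App t1 t2 : \<langle>\<Gamma> \<turnstile> T0\<rangle>/((C1 \<^bold>\<and> D1 \<^bold>\<and> L) \<^bold>\<and> (C2 \<^bold>\<and> D2))"
      unfolding P subst_skel_simps co L_def by (rule typing.App[OF typing.Co[OF 1(2)] 2(3)])
    moreover have "((C1 \<^bold>\<and> D1 \<^bold>\<and> L) \<^bold>\<and> (C2 \<^bold>\<and> D2)) = (C0 \<^bold>\<and> (D1 \<^bold>\<and> L \<^bold>\<and> D2))"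
      unfolding C0 by (simp only: Conj_ac)
    ultimately have "subst_skel \<sigma>' P \<triangleright> App t1 t2 : \<langle>\<Gamma> \<turnstile> T0\<rangle>/(C0 \<^bold>\<and> (D1 \<^bold>\<and> L \<^bold>\<and> D2))" by simp
    moreover have "reflexive_constr (D1 \<^bold>\<and> L \<^bold>\<and> D2)"
      unfolding L_def using 1(1) 2(2) by (intro reflexive_constr.intros)
    ultimately show ?thesis
      by (intro instantiates_SExp[OF App(1) env s SP ty E])
  qed
  moreover have "subst_val \<sigma> v = subst_val \<sigma>0 v"
    if v: "v |\<notin>| var_skel ?Q |-| Inl |`| ftv_env \<Xi>" for v
  proof -
    have "a |\<notin>| ftv_env \<Xi>" using new(1) ftvQ by (auto simp del: fUnions_iff)
    with v sub[of v] have "v \<noteq> Inl a" "v \<noteq> Inr s" by (auto simp del: fUnions_iff)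
    moreover have "v |\<notin>| var_skel Q1 |-| Inl |`| ftv_env \<Xi>" "v |\<notin>| var_skel Q2 |-| Inl |`| ftv_env \<Xi>"
      using v sub[of v] by (auto simp del: fUnions_iff)
    ultimately show ?thesis using \<sigma> \<sigma>1 \<sigma>2 by simp
  qed
  ultimately show ?case unfolding \<Gamma>_def[symmetric] A by blast
qed

theorem theorem5p4:
  fixes t :: tm and Q Q' :: skel and \<Gamma> :: env and T :: ty and C :: constr
  assumes "initial_skel Q t"
    and "Q' \<triangleright> t : \<langle>\<Gamma> \<turnstile> T\<rangle>/C"
  shows "\<exists>(\<sigma> :: subst) (\<Gamma>' :: env) (C' :: constr). reflexive_constr C' \<and>
    Weaken (subst_skel \<sigma> Q) \<Gamma>' \<triangleright>\<^sub>w t : \<langle>\<Gamma> \<turnstile> T\<rangle>/(C \<^bold>\<and> C')"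
proof -
  \<comment> \<open>An initial skeleton assigns types to the free variables of \<open>t\<close>
    only; the remaining assignments are supplied by weakening.\<close>
  define \<Gamma>1 where "\<Gamma>1 = fmrestrict_fset (fv t) \<Gamma>"
  define \<Gamma>2 where "\<Gamma>2 = fmdrop_fset (fv t) \<Gamma>"
  have \<Gamma>: "\<Gamma> = \<Gamma>1 ++\<^sub>f \<Gamma>2" unfolding \<Gamma>1_def \<Gamma>2_def by (rule fmap_ext) auto
  have disj: "fmdom \<Gamma>1 |\<inter>| fmdom \<Gamma>2 = {||}" unfolding \<Gamma>1_def \<Gamma>2_def by auto
  obtain \<Xi> where \<Xi>: "variable_env \<Xi>" "fmdom \<Xi> = fv t" "init \<Xi> t Q"
    using assms(1) unfolding initial_skel_def by blast
  have "fmdom \<Gamma>1 = fmdom \<Xi>"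
    unfolding \<Gamma>1_def \<Xi>(2) fmdom'_restrict_fset_precise
    using typing_fv[OF assms(2)] by (rule inf_absorb2)
  with \<Xi>(1) obtain \<sigma>0 where \<sigma>0: "subst_env \<sigma>0 \<Xi> = \<Gamma>1" using ex_subst_variable_env by blast
  obtain R where "R \<triangleright> t : \<langle>subst_env \<sigma>0 \<Xi> \<turnstile> T\<rangle>/C"
    using typing_strengthen[OF assms(2) order_refl] unfolding \<sigma>0 \<Gamma>1_def by blast
  \<comment> \<open>The conclusion is used for the substitution found there, which agrees with
    itself on all variables.\<close>
  from init_instance[OF \<Xi>(3) this] obtain \<sigma> C' where
    "reflexive_constr C'" "subst_skel \<sigma> Q \<triangleright> t : \<langle>\<Gamma>1 \<turnstile> T\<rangle>/(C \<^bold>\<and> C')"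
    unfolding instantiates_def \<sigma>0 by blast
  with disj show ?thesis unfolding \<Gamma> by (blast intro: weak_typing.intros)
qed

end
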